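(* Let $n\ge1$ and let $\pi:W_n\to W_{n-1}$ be the deletion map erasing the letter $\pm n$. Then the augmented Reeb poset $\widehat{\mathsf{Reeb}}(\pi)$ is the total order induced by the valuation $\nu$: for all vertices $x,y$ of $\widehat R(\pi)$, $$x\le_{\widehat{\mathsf{Reeb}}(\pi)}y\iff\nu(x)\le\nu(y).$$
   Context: $[m]=\{1,\dots,m\}$. $W_n$ is the hyperoctahedral group, written as words in the letters $\{\pm1,\dots,\pm n\}$ using each absolute value exactly once ($W_0$ consists of the empty word). With the signed order $-n<\cdots<-1<1<\cdots<n$, the (right) weak order on $W_n$ is the poset whose covers $u\to v$ are: (1) adjacent swaps $\cdots a\,b\cdots\mapsto\cdots b\,a\cdots$ whenever $a<b$ in the signed order; (2) the sign flip of the first letter $a_1\mapsto -a_1$ whenever $a_1>0$. The map $\pi:W_n\to W_{n-1}$ deletes the letter of absolute value $n$. For every cover $v\to w$ in $W_n$, either $\pi(v)=\pi(w)$ (vertical cover) or $\pi(v)\to\pi(w)$ is a cover in $W_{n-1}$ (horizontal cover). Let $\sim_h$ be the equivalence relation on $W_n$ generated by $v\sim_h w$ for horizontal covers $v\to w$; $[v]$ denotes the class of $v$. The pre-Reeb graph $R(\pi)$ is the directed graph whose vertices are the $\sim_h$-classes, with an edge $[v]\to[w]$ whenever there are $v'\in[v]$, $w'\in[w]$ such that $v'\to w'$ is a vertical cover. The vertices are identified with the pairs $x=(\varepsilon,A)$, where $\varepsilon\in\{+,-\}$ and $A\subseteq\{\pm1,\dots,\pm(n-1)\}$ contains at most one of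 $+i,-i$ for each $i\in[n-1]$: the class $[w]$ corresponds to $\varepsilon$ = the sign of the letter $\pm n$ occurring in $w$, and $A$ = the set of signed letters of $w$ lying to the right of the letter $\pm n$. The augmented pre-Reeb graph $\widehat R(\pi)$ is obtained from $R(\pi)$ by adding an auxiliary edge $[v]\to[w]$ whenever there are $v'\in[v]$, $w'\in[w]$ such that $\pi(w')<\pi(v')$ in $W_{n-1}$ and $v',w'$ are incomparable in $W_n$. In the present setting $\widehat R(\pi)$ is acyclic, and the augmented Reeb poset $\widehat{\mathsf{Reeb}}(\pi)$ is its reachability poset: $x\le_{\widehat{\mathsf{Reeb}}(\pi)}y$ iff there is a directed path (possibly of length 0) from $x$ to $y$ in $\widehat R(\pi)$. Valuation: for $x=(\varepsilon,A)$ put $|A|:=\{|a|: a\in A\}\subseteq[n-1]$. Define bits in $\{0,1\}$ by $(-n)(x):=\mathbf 1_{\varepsilon=-}$ and, for $i\in[n-1]$, $(n,i)(x):=\mathbf 1_{+i\in A}+\mathbf 1_{\varepsilon=-,\ i\notin|A|}$, $(n,-i)(x):=\mathbf 1_{-i\in A}+\mathbf 1_{\varepsilon=-,\ i\notin|A|}$. Then $$\nu(x):=\sum_{i=1}^{n-1}(n,-i)(x)\,2^{n-1-i}+(-n)(x)\,2^{n-1}+\sum_{i=1}^{n-1}(n,i)(x)\,2^{n-1+i}.$$ *)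

theory Defs
  imports Main
begin

definition hyperoct :: "nat \<Rightarrow> int list set" where
  "hyperoct n = {w. distinct (map abs w) \<and> abs ` set w = {1..int n}}"

inductive weak_step :: "int list \<Rightarrow> int list \<Rightarrow> bool" where
  swap: "a < b \<Longrightarrow> weak_step (xs @ a # b # ys) (xs @ b # a # ys)"
| flip: "0 < a \<Longrightarrow> weak_step (a # ys) ((- a) # ys)"

definition weak_cover :: "nat \<Rightarrow> int list \<Rightarrow> int list \<Rightarrow> bool" where
  "weak_cover n u v \<longleftrightarrow> u \<in> hyperoct n \<and> v \<in> hyperoct n \<and> weak_step u v"

definition weak_le :: "nat \<Rightarrow> int list \<Rightarrow> int list \<Rightarrow> bool" where
  "weak_le n u v \<longleftrightarrow> u \<in> hyperoct n \<and> v \<in> hyperoct n \<and> (weak_cover n)\<^sup>*\<^sup>* u v"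

definition weak_less :: "nat \<Rightarrow> int list \<Rightarrow> int list \<Rightarrow> bool" where
  "weak_less n u v \<longleftrightarrow> weak_le n u v \<and> u \<noteq> v"

text \<open>The deletion map from \<open>hyperoct n\<close> to \<open>hyperoct (n - 1)\<close>; it and everything built on it
  is meant for \<open>n \<ge> 1\<close>.\<close>

definition del :: "nat \<Rightarrow> int list \<Rightarrow> int list" where
  "del n w = filter (\<lambda>a. \<bar>a\<bar> \<noteq> int n) w"

definition vertical_cover :: "nat \<Rightarrow> int list \<Rightarrow> int list \<Rightarrow> bool" where
  "vertical_cover n v w \<longleftrightarrow> weak_cover n v w \<and> del n v = del n w"

definition horizontal_cover :: "nat \<Rightarrow> int list \<Rightarrow> int list \<Rightarrow> bool" where
  "horizontal_cover n v w \<longleftrightarrow> weak_cover n v w \<and> weak_cover (n - 1) (del n v) (del n w)"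

definition hrel :: "nat \<Rightarrow> int list rel" where
  "hrel n = {(v, w). v \<in> hyperoct n \<and> w \<in> hyperoct n \<and> equivclp (horizontal_cover n) v w}"

definition reeb_vertices :: "nat \<Rightarrow> int list set set" where
  "reeb_vertices n = hyperoct n // hrel n"

definition reeb_edge :: "nat \<Rightarrow> int list set \<Rightarrow> int list set \<Rightarrow> bool" where
  "reeb_edge n X Y \<longleftrightarrow> X \<in> reeb_vertices n \<and> Y \<in> reeb_vertices n \<and>
     (\<exists>v\<in>X. \<exists>w\<in>Y. vertical_cover n v w)"

definition aux_edge :: "nat \<Rightarrow> int list set \<Rightarrow> int list set \<Rightarrow> bool" where
  "aux_edge n X Y \<longleftrightarrow> X \<in> reeb_vertices n \<and> Y \<in> reeb_vertices n \<and>
     (\<exists>v\<in>X. \<exists>w\<in>Y. weak_less (n - 1) (del n w) (del n v) \<and>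
        \<not> weak_le n v w \<and> \<not> weak_le n w v)"

definition aug_edge :: "nat \<Rightarrow> int list set \<Rightarrow> int list set \<Rightarrow> bool" where
  "aug_edge n X Y \<longleftrightarrow> reeb_edge n X Y \<or> aux_edge n X Y"

definition aug_reeb :: "nat \<Rightarrow> int list set rel" where
  "aug_reeb n = {(X, Y). X \<in> reeb_vertices n \<and> Y \<in> reeb_vertices n \<and> (aug_edge n)\<^sup>*\<^sup>* X Y}"

text \<open>The pair \<open>(\<epsilon>, A)\<close> of a word: \<open>\<epsilon> \<in> {1, -1}\<close> is the sign of the letter of absolute
  value \<open>n\<close>, and \<open>A\<close> is the set of letters to its right.\<close>

definition word_code :: "nat \<Rightarrow> int list \<Rightarrow> int \<times> int set" where
  "word_code n w =
     (if int n \<in> set w then 1 else - 1, set (tl (dropWhile (\<lambda>a. \<bar>a\<bar> \<noteq> int n) w)))"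

text \<open>The pair of a vertex is the common pair of its elements; see \<open>vertex_code_eq\<close> below.\<close>

definition vertex_code :: "nat \<Rightarrow> int list set \<Rightarrow> int \<times> int set" where
  "vertex_code n X = the_elem (word_code n ` X)"

definition bit_neg :: "int \<times> int set \<Rightarrow> nat" where
  "bit_neg = (\<lambda>(e, A). of_bool (e = - 1))"

text \<open>\<open>bit_pair x j\<close> is the bit \<open>(n, j)(x)\<close>, for \<open>j\<close> of either sign.\<close>

definition bit_pair :: "int \<times> int set \<Rightarrow> int \<Rightarrow> nat" where
  "bit_pair = (\<lambda>(e, A) j. of_bool (j \<in> A) + of_bool (e = - 1 \<and> \<bar>j\<bar> \<notin> abs ` A))"

definition val :: "nat \<Rightarrow> int \<times> int set \<Rightarrow> nat" where
  "val n x = (\<Sum>i = 1..n - 1. bit_pair x (- int i) * 2 ^ (n - 1 - i))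
     + bit_neg x * 2 ^ (n - 1)
     + (\<Sum>i = 1..n - 1. bit_pair x (int i) * 2 ^ (n - 1 + i))"

lemma weak_step_irrefl: "weak_step u v \<Longrightarrow> u \<noteq> v"
  by (induction rule: weak_step.induct) auto

lemma set_tl_dropWhile_swap:
  assumes "P a" "P b"
  shows "set (tl (dropWhile P (xs @ a # b # ys))) = set (tl (dropWhile P (xs @ b # a # ys)))"
  using assms by (induction xs) auto

lemma horizontal_cover_word_code:
  assumes "horizontal_cover n v w"
  shows "word_code n v = word_code n w"
proof -
  let ?P = "\<lambda>a. \<bar>a\<bar> \<noteq> int n"
  from assms have step: "weak_step v w" and ne: "filter ?P v \<noteq> filter ?P w"
    by (auto simp: horizontal_cover_def weak_cover_def del_def dest: weak_step_irrefl)
  from step show ?thesis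
  proof cases
    case (swap a b xs ys)
    have ab: "?P a" "?P b"
      using ne by (cases "?P a"; cases "?P b"; simp add: swap)+
    have "set (tl (dropWhile ?P v)) = set (tl (dropWhile ?P w))"
      unfolding swap(1,2) by (rule set_tl_dropWhile_swap[where P = ?P, OF ab])
    moreover have "set v = set w"
      unfolding swap by auto
    ultimately show ?thesis
      by (simp only: word_code_def)
  next
    case (flip a ys)
    have a: "?P a"
      using ne by (cases "?P a") (simp_all add: flip)
    then have "(int n \<in> set v) = (int n \<in> set w)"
      unfolding flip by auto
    moreover have "dropWhile ?P v = dropWhile ?P w"
      using a unfolding flip by simp
    ultimately show ?thesis
      by (simp only: word_code_def)
  qed
qed

lemma hrel_word_code:
  assumes "(v, w) \<in> hrel n"
  shows "word_code n v = word_code n w"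
proof -
  have "equivclp (horizontal_cover n) v w"
    using assms by (simp add: hrel_def)
  then show ?thesis
    by (induction rule: equivclp_induct) (auto dest: horizontal_cover_word_code)
qed

lemma vertex_code_eq:
  assumes "X \<in> reeb_vertices n" "w \<in> X"
  shows "vertex_code n X = word_code n w"
proof -
  obtain u where u: "X = hrel n `` {u}"
    using assms(1) by (auto simp: reeb_vertices_def quotient_def)
  define c where "c = word_code n w"
  have "word_code n v = c" if "v \<in> X" for v
    using that assms(2) hrel_word_code[of u v n] hrel_word_code[of u w n] by (simp add: u c_def)
  then have "word_code n ` X = {c}"
    using assms(2) by auto
  then show ?thesis
    by (simp add: vertex_code_def c_def)
qed

end

theory Submission
  imports Defs
begin

text \<open>
Write a word together with its negated mirror image and a \<open>0\<close> in between, as the list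
\<open>full w\<close> of all the numbers \<open>- n, \<dots>, n\<close>. Read this way, every cover of the weak
order reverses increasing stretches of neighbours, and the weak order becomes containment of
the sets of inversions, that is, of the pairs \<open>(a, b)\<close> with \<open>b < a\<close> and \<open>a\<close> before \<open>b\<close>
(\<open>weak_le_iff_inversions\<close>). The bits in the valuation are the inversions that involve the letter
of absolute value \<open>n\<close>: the bit of weight \<open>2 ^ (n - 1 + j)\<close> says whether \<open>n\<close> stands before \<open>j\<close>,
where \<open>j\<close> runs over \<open>- (n - 1), \<dots>, n - 1\<close> and \<open>j = 0\<close> gives the sign bit. Deleting the letter
of absolute value \<open>n\<close> forgets just these inversions.

Edges cannot decrease the valuation (\<open>code_edge_val_le\<close>). A vertical cover only adds inversions, hence
bits. For an auxiliary edge from \<open>v\<close> to \<open>w\<close>, every inversion of \<open>w\<close> not involving \<open>n\<close> is one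
of \<open>v\<close>, so \<open>w\<close>, not being below \<open>v\<close>, has a bit \<open>j\<close> that \<open>v\<close> lacks. If \<open>v\<close> had a higher bit
\<open>i > j\<close> that \<open>w\<close> lacks, then \<open>i\<close> would come before \<open>n\<close> and \<open>n\<close> before \<open>j\<close> in \<open>w\<close>, and \<open>j\<close>
before \<open>n\<close> and \<open>n\<close> before \<open>i\<close> in \<open>v\<close>; so \<open>(i, j)\<close> would be an inversion of \<open>w\<close> but not of
\<open>v\<close>. Hence the top bit where they differ belongs to \<open>w\<close>.

Conversely, the valuation is injective on pairs, so a path from \<open>x\<close> to every \<open>y\<close> of larger value
exists once there is always one edge from \<open>x\<close> to some \<open>z \<noteq> x\<close> of value at most that of \<open>y\<close>
(\<open>exists_code_edge\<close>). To find edges it helps to record \<open>A\<close> by the odd function \<open>side A\<close>, which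
is \<open>1\<close> on \<open>A\<close>, \<open>- 1\<close> on \<open>- A\<close> and \<open>0\<close> elsewhere; the bit \<open>j\<close> then says that \<open>side A j\<close>
reaches the level \<open>1\<close> (positive \<open>n\<close>) or \<open>0\<close> (negative \<open>n\<close>). Let \<open>j0\<close> be the top bit where
\<open>x\<close> and \<open>y\<close> differ. If a vertical cover adds a bit below \<open>j0\<close>, it is the required edge. Otherwise
\<open>x\<close> is saturated below \<open>j0\<close>, and \<open>z\<close> agrees with \<open>x\<close> above \<open>j0\<close>, has the bit \<open>j0\<close>, and
below \<open>j0\<close> only the bits forced by the higher ones. The edge to this \<open>z\<close> is a vertical cover, or an
auxiliary edge given by the most inverted word of \<open>x\<close> and the least inverted word of \<open>z\<close>
(\<open>code_edge_aux\<close>). Only when \<open>j0 \<ge> 0\<close> and \<open>n\<close> is positive in \<open>x\<close> is \<open>z\<close> chosen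
differently: the other letters then all stand to the right of \<open>n\<close>, and \<open>z\<close> arises by
flipping the sign of \<open>n\<close>.

All edges are studied on pairs rather than on classes. This is legitimate because words with the same
pair are related by horizontal covers (\<open>hrel_if_same_code\<close>): the letters to the right of
\<open>n\<close> may be permuted, and those to its left may be permuted and change sign.
\<close>

section \<open>The order of the entries of a list\<close>

fun prec :: "'a list \<Rightarrow> 'a \<Rightarrow> 'a \<Rightarrow> bool" where
  "prec [] a b \<longleftrightarrow> False"
| "prec (x # xs) a b \<longleftrightarrow> x = a \<and> b \<in> set xs \<or> prec xs a b"

lemma prec_in_set: "prec xs a b \<Longrightarrow> a \<in> set xs \<and> b \<in> set xs"
  by (induction xs) auto

lemma prec_append:
  "prec (xs @ ys) a b \<longleftrightarrow> prec xs a b \<or> prec ys a b \<or> a \<in> set xs \<and> b \<in> set ys"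
  by (induction xs) auto

lemma prec_rev: "prec (rev xs) a b \<longleftrightarrow> prec xs b a"
  by (induction xs) (auto simp: prec_append)

lemma prec_map_uminus:
  fixes xs :: "int list"
  shows "prec (map uminus xs) a b \<longleftrightarrow> prec xs (- a) (- b)"
  by (induction xs) force+

lemma prec_filter: "prec (filter P xs) a b \<longleftrightarrow> P a \<and> P b \<and> prec xs a b"
  by (induction xs) (auto dest: prec_in_set)

lemma sorted_wrt_iff_prec: "sorted_wrt R xs \<longleftrightarrow> (\<forall>a b. prec xs a b \<longrightarrow> R a b)"
  by (induction xs) auto

lemma prec_total: "a \<in> set xs \<Longrightarrow> b \<in> set xs \<Longrightarrow> a \<noteq> b \<Longrightarrow> prec xs a b \<or> prec xs b a"
  by (induction xs) auto

lemma prec_asym: "distinct xs \<Longrightarrow> prec xs a b \<Longrightarrow> \<not> prec xs b a"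
  by (induction xs) (auto dest: prec_in_set)

lemma prec_trans: "distinct xs \<Longrightarrow> prec xs a b \<Longrightarrow> prec xs b c \<Longrightarrow> prec xs a c"
  by (induction xs) (auto dest: prec_in_set)

text \<open>Containment of the orders suffices because both are total on the same set of entries.\<close>

lemma eq_if_prec_le:
  assumes "distinct xs" "distinct ys" "set xs = set ys" "\<And>a b. prec xs a b \<Longrightarrow> prec ys a b"
  shows "xs = ys"
  using assms
proof (induction xs arbitrary: ys)
  case (Cons x xs)
  then obtain y ys' where ys: "ys = y # ys'" by (cases ys) auto
  have "y = x"
  proof (rule ccontr)
    assume "y \<noteq> x"
    then have "prec (x # xs) x y" using Cons.prems(3) ys by auto
    then have "prec ys x y" by (rule Cons.prems(4))
    then show False using Cons.prems(2) \<open>y \<noteq> x\<close> by (auto simp: ys dest: prec_in_set)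
  qed
  moreover have "xs = ys'"
  proof (rule Cons.IH)
    show "set xs = set ys'" using Cons.prems(1-3) \<open>y = x\<close> by (auto simp: ys)
    show "prec ys' a b" if "prec xs a b" for a b
      using Cons.prems(4)[of a b] Cons.prems(1) that \<open>y = x\<close> by (auto simp: ys dest: prec_in_set)
  qed (use Cons.prems ys in auto)
  ultimately show ?case by (simp add: ys)
qed simp

section \<open>Inversions of signed words\<close>

text \<open>The central \<open>0\<close> turns the sign of a letter \<open>a\<close> into an order relation as well: \<open>a\<close>
  stands before \<open>0\<close> exactly when \<open>- a\<close> is the letter that occurs in \<open>w\<close>.\<close>

definition full :: "int list \<Rightarrow> int list" where
  "full w = map uminus (rev w) @ 0 # w"

definition before :: "int list \<Rightarrow> int \<Rightarrow> int \<Rightarrow> bool" where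
  "before w = prec (full w)"

definition inversions :: "int list \<Rightarrow> (int \<times> int) set" where
  "inversions w = {(a, b). b < a \<and> before w a b}"

text \<open>The disjuncts say where the two entries lie: both in the mirrored half, both in \<open>w\<close>, one in
  each half, or one of them at the centre.\<close>

lemma before_iff:
  "before w a b \<longleftrightarrow> prec w (- b) (- a) \<or> prec w a b \<or> - a \<in> set w \<and> b \<in> set w
     \<or> a = 0 \<and> b \<in> set w \<or> b = 0 \<and> - a \<in> set w"
proof -
  have "(a \<in> uminus ` set w) = (- a \<in> set w)" by force
  then show ?thesis
    unfolding before_def full_def by (auto simp: prec_append prec_map_uminus prec_rev rev_map[symmetric])
qed

lemma before_uminus: "before w (- a) (- b) \<longleftrightarrow> before w b a"
  by (auto simp: before_iff)

lemma hyperoct_mem_iff: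
  assumes "w \<in> hyperoct n" "a \<noteq> 0"
  shows "a \<in> set w \<longleftrightarrow> \<bar>a\<bar> \<le> int n \<and> - a \<notin> set w"
proof
  have d: "distinct (map abs w)" and s: "abs ` set w = {1..int n}"
    using assms(1) by (auto simp: hyperoct_def)
  have inj: "inj_on abs (set w)" using d by (simp add: distinct_map)
  {
    assume a: "a \<in> set w"
    then have "\<bar>a\<bar> \<in> {1..int n}" using s by blast
    moreover have "- a \<notin> set w" using inj_onD[OF inj, of a "- a"] a assms(2) by auto
    ultimately show "\<bar>a\<bar> \<le> int n \<and> - a \<notin> set w" by simp
  }
  {
    assume a: "\<bar>a\<bar> \<le> int n \<and> - a \<notin> set w"
    then have "\<bar>a\<bar> \<in> abs ` set w" unfolding s using assms(2) by auto
    then obtain b where "b \<in> set w" "\<bar>a\<bar> = \<bar>b\<bar>" by auto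
    then show "a \<in> set w" using a by (auto simp: abs_eq_iff)
  }
qed

lemma hyperoct_zero: "w \<in> hyperoct n \<Longrightarrow> 0 \<notin> set w"
  by (force simp: hyperoct_def)

lemma hyperoct_le: "w \<in> hyperoct n \<Longrightarrow> a \<in> set w \<Longrightarrow> \<bar>a\<bar> \<le> int n"
  using hyperoct_mem_iff[of w n a] hyperoct_zero[of w n] by (cases "a = 0") auto

lemma set_full:
  assumes "w \<in> hyperoct n"
  shows "set (full w) = {- int n..int n}"
proof (rule set_eqI)
  fix a
  have "(a \<in> uminus ` set w) = (- a \<in> set w)" by force
  then have "a \<in> set (full w) \<longleftrightarrow> a = 0 \<or> a \<in> set w \<or> - a \<in> set w"
    by (auto simp: full_def)
  also have "\<dots> \<longleftrightarrow> a \<in> {- int n..int n}"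
    using hyperoct_mem_iff[OF assms, of a] hyperoct_mem_iff[OF assms, of "- a"] hyperoct_zero[OF assms]
    by (cases "a = 0") auto
  finally show "a \<in> set (full w) \<longleftrightarrow> a \<in> {- int n..int n}" .
qed

lemma distinct_hyperoct: "w \<in> hyperoct n \<Longrightarrow> distinct w"
  by (auto simp: hyperoct_def distinct_map)

lemma distinct_full:
  assumes "w \<in> hyperoct n"
  shows "distinct (full w)"
proof -
  have "set w \<inter> uminus ` set w = {}"
  proof (rule equals0I)
    fix a assume "a \<in> set w \<inter> uminus ` set w"
    then have "a \<in> set w" "- a \<in> set w" by auto
    then show False using hyperoct_mem_iff[OF assms, of a] hyperoct_zero[OF assms] by metis
  qed
  then show ?thesis
    using distinct_hyperoct[OF assms] hyperoct_zero[OF assms]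
    unfolding full_def by (auto simp: distinct_map)
qed

lemma before_total:
  "w \<in> hyperoct n \<Longrightarrow> \<bar>a\<bar> \<le> int n \<Longrightarrow> \<bar>b\<bar> \<le> int n \<Longrightarrow> a \<noteq> b \<Longrightarrow> before w a b \<or> before w b a"
  unfolding before_def by (rule prec_total) (auto simp: set_full)

lemma before_asym: "w \<in> hyperoct n \<Longrightarrow> before w a b \<Longrightarrow> \<not> before w b a"
  unfolding before_def by (rule prec_asym[OF distinct_full])

lemma before_trans: "w \<in> hyperoct n \<Longrightarrow> before w a b \<Longrightarrow> before w b c \<Longrightarrow> before w a c"
  unfolding before_def by (rule prec_trans[OF distinct_full])

lemma before_le:
  assumes "w \<in> hyperoct n" "before w a b"
  shows "\<bar>a\<bar> \<le> int n" "\<bar>b\<bar> \<le> int n"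
proof -
  have "a \<in> {- int n..int n}" "b \<in> {- int n..int n}"
    using assms(2) prec_in_set[of "full w" a b] unfolding set_full[OF assms(1)] before_def by blast+
  then show "\<bar>a\<bar> \<le> int n" "\<bar>b\<bar> \<le> int n" by auto
qed

text \<open>By symmetry, \<open>a\<close> and \<open>- a\<close> lie on opposite sides of the centre.\<close>

lemma before_uminus_self:
  assumes w: "w \<in> hyperoct n"
  shows "before w a (- a) \<longleftrightarrow> before w a 0"
proof (cases "a = 0")
  case False
  show ?thesis
  proof
    assume *: "before w a (- a)"
    show "before w a 0"
    proof (rule ccontr)
      assume "\<not> before w a 0"
      then have 1: "before w 0 a" using before_total[OF w, of a 0] before_le[OF w *] False by auto
      then have "before w (- a) 0" using before_uminus[of w a 0] by simp
      then have "before w (- a) a" using 1 by (rule before_trans[OF w])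
      then show False using * before_asym[OF w] by blast
    qed
  next
    assume *: "before w a 0"
    then have "before w 0 (- a)" using before_uminus[of w 0 a] by simp
    with * show "before w a (- a)" by (rule before_trans[OF w])
  qed
qed simp

lemma before_del:
  assumes "n \<ge> 1"
  shows "before (del n w) a b \<longleftrightarrow> \<bar>a\<bar> \<noteq> int n \<and> \<bar>b\<bar> \<noteq> int n \<and> before w a b"
proof -
  have "full (del n w) = filter (\<lambda>a. \<bar>a\<bar> \<noteq> int n) (full w)"
    using assms by (auto simp: full_def del_def rev_filter filter_map o_def)
  then show ?thesis by (simp add: before_def prec_filter)
qed

lemma del_hyperoct:
  assumes "n \<ge> 1" "w \<in> hyperoct n"
  shows "del n w \<in> hyperoct (n - 1)"
proof -
  have "abs ` set (del n w) = abs ` set w - {int n}"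
    by (auto simp: del_def)
  also have "\<dots> = {1..int (n - 1)}"
    using assms by (auto simp: hyperoct_def)
  finally show ?thesis
    using assms(2) by (auto simp: hyperoct_def del_def distinct_map intro: inj_on_subset)
qed

text \<open>The disjuncts on either side put back the one pair whose order is exchanged.\<close>

lemma prec_swap:
  "prec (xs @ b # a # ys) p q \<or> p = a \<and> q = b \<longleftrightarrow> prec (xs @ a # b # ys) p q \<or> p = b \<and> q = a"
  by (simp add: prec_append) blast

lemma swap_inversions:
  assumes "a < b"
  shows "inversions (xs @ b # a # ys) = inversions (xs @ a # b # ys) \<union> {(b, a), (- a, - b)}"
proof -
  have "(p, q) \<in> inversions (xs @ b # a # ys)
      \<longleftrightarrow> (p, q) \<in> inversions (xs @ a # b # ys) \<or> (p, q) = (b, a) \<or> (p, q) = (- a, - b)" for p q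
  proof (cases "q < p")
    case True
    have 1: "prec (xs @ b # a # ys) p q \<longleftrightarrow> prec (xs @ a # b # ys) p q \<or> p = b \<and> q = a"
    proof -
      have "\<not> (p = a \<and> q = b)" using assms True by linarith
      then show ?thesis using prec_swap[of xs b a ys p q] by blast
    qed
    have 2: "prec (xs @ b # a # ys) (- q) (- p) \<longleftrightarrow> prec (xs @ a # b # ys) (- q) (- p) \<or> p = - a \<and> q = - b"
    proof -
      have "\<not> (- q = a \<and> - p = b)" "(- q = b \<and> - p = a) = (p = - a \<and> q = - b)"
        using assms True by linarith+
      then show ?thesis using prec_swap[of xs b a ys "- q" "- p"] by blast
    qed
    have 3: "set (xs @ b # a # ys) = set (xs @ a # b # ys)" by auto
    show ?thesis
      unfolding inversions_def mem_Collect_eq case_prod_conv before_iff 1 2 3 using True by blast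
  next
    case False
    then show ?thesis using assms by (auto simp: inversions_def)
  qed
  then show ?thesis by auto
qed

lemma flip_inversions:
  assumes "0 < a"
  shows "inversions (- a # ys) = inversions (a # ys) \<union> {(a, 0), (0, - a), (a, - a)}"
proof -
  have "(p, q) \<in> inversions (- a # ys)
      \<longleftrightarrow> (p, q) \<in> inversions (a # ys) \<or> (p, q) = (a, 0) \<or> (p, q) = (0, - a) \<or> (p, q) = (a, - a)" for p q
  proof (cases "q < p")
    case True
    have neg: "(- x = - a) = (x = a)" "(- x = a) = (x = - a)" for x :: int by auto
    show ?thesis
      using True assms unfolding inversions_def mem_Collect_eq case_prod_conv before_iff prec.simps
        list.set insert_iff neg by auto
  next
    case False
    then show ?thesis using assms by (auto simp: inversions_def)
  qed
  then show ?thesis by auto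
qed

lemma weak_step_inversions: "weak_step u v \<Longrightarrow> inversions u \<subseteq> inversions v"
  by (induction rule: weak_step.induct) (auto simp: swap_inversions flip_inversions)

text \<open>The easy half of the characterisation of the weak order: no cover destroys an inversion.\<close>

lemma weak_le_inversions:
  assumes "weak_le n u v"
  shows "inversions u \<subseteq> inversions v"
proof -
  have "(weak_cover n)\<^sup>*\<^sup>* u v" using assms by (simp add: weak_le_def)
  then show ?thesis
    by induction (use weak_step_inversions in \<open>auto simp: weak_cover_def\<close>)
qed

section \<open>The weak order is containment of inversion sets\<close>

lemma finite_inversions: "w \<in> hyperoct n \<Longrightarrow> finite (inversions w)"
  by (rule finite_subset[of _ "set (full w) \<times> set (full w)"])
    (auto simp: inversions_def before_def dest: prec_in_set)

lemma weak_step_hyperoct: "weak_step u v \<Longrightarrow> u \<in> hyperoct n \<Longrightarrow> v \<in> hyperoct n"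
  by (induction rule: weak_step.induct) (auto simp: hyperoct_def)

text \<open>If no upward step from \<open>u\<close> stays below \<open>v\<close>, then any two neighbours in \<open>0 # u\<close> stand in \<open>v\<close>
  in the same order: an ascending pair inverted in \<open>v\<close> could be exchanged, and a descending one is
  an inversion of \<open>u\<close>, hence of \<open>v\<close>. By transitivity all pairs stand in the same order, and the
  words are equal.\<close>

lemma exists_weak_step:
  assumes u: "u \<in> hyperoct n" and v: "v \<in> hyperoct n"
    and sub: "inversions u \<subseteq> inversions v" and ne: "u \<noteq> v"
  obtains u' where "weak_step u u'" "inversions u' \<subseteq> inversions v" "inversions u \<noteq> inversions u'"
proof (rule ccontr)
  assume "\<not> thesis"
  then have none: "\<not> (weak_step u u' \<and> inversions u' \<subseteq> inversions v \<and> inversions u \<noteq> inversions u')" for u'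
    using that by blast
  \<comment> \<open>The leading \<open>0\<close> lets the sign flip of the first letter be treated as the exchange of \<open>0\<close> with it.\<close>
  have adj: "before v a b" if eq: "0 # u = xs @ a # b # ys" for xs a b ys
  proof (cases xs)
    case Nil
    then have e: "a = 0" "u = b # ys" using eq by auto
    have b: "\<bar>b\<bar> \<le> int n" "b \<noteq> 0" using u hyperoct_le hyperoct_zero by (force simp: e)+
    have bu: "before u 0 b" by (auto simp: before_iff e)
    show ?thesis
    proof (cases "0 < b")
      case True
      have "\<not> before v b 0"
      proof
        assume *: "before v b 0"
        have "before v 0 (- b)" using * before_uminus[of v 0 b] by simp
        moreover have "before v b (- b)" using * before_uminus_self[OF v] by simp
        ultimately have "{(b, 0), (0, - b), (b, - b)} \<subseteq> inversions v"
          using * True by (auto simp: inversions_def)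
        then have "inversions (- b # ys) \<subseteq> inversions v"
          using sub unfolding flip_inversions[OF True] e(2) by blast
        moreover have "(b, 0) \<notin> inversions u" using bu before_asym[OF u] by (auto simp: inversions_def)
        moreover have "(b, 0) \<in> inversions (- b # ys)" by (simp add: flip_inversions[OF True])
        ultimately show False using none[of "- b # ys"] weak_step.flip[OF True, of ys] e by metis
      qed
      then show ?thesis using before_total[OF v, of b 0] b e by auto
    next
      case False
      then have "(0, b) \<in> inversions u" using b bu by (auto simp: inversions_def)
      then show ?thesis using sub e by (auto simp: inversions_def)
    qed
  next
    case (Cons c xs')
    then have e: "u = xs' @ a # b # ys" using eq by auto
    have ab: "\<bar>b\<bar> \<le> int n" "\<bar>a\<bar> \<le> int n" "a \<noteq> b"
      using u hyperoct_le distinct_hyperoct[OF u] by (force simp: e)+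
    have bu: "before u a b" by (auto simp: before_iff e prec_append)
    show ?thesis
    proof (cases "a < b")
      case True
      have "\<not> before v b a"
      proof
        assume *: "before v b a"
        have "before v (- a) (- b)" using * before_uminus by simp
        then have "{(b, a), (- a, - b)} \<subseteq> inversions v"
          using * True by (auto simp: inversions_def)
        then have "inversions (xs' @ b # a # ys) \<subseteq> inversions v"
          using sub unfolding swap_inversions[OF True] e by blast
        moreover have "(b, a) \<notin> inversions u" using bu before_asym[OF u] by (auto simp: inversions_def)
        moreover have "(b, a) \<in> inversions (xs' @ b # a # ys)" by (simp add: swap_inversions[OF True])
        ultimately show False using none weak_step.swap[OF True, of xs' ys] e by metis
      qed
      then show ?thesis using before_total[OF v, of b a] ab by auto
    next
      case False
      then have "(a, b) \<in> inversions u" using ab bu by (auto simp: inversions_def)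
      then show ?thesis using sub by (auto simp: inversions_def)
    qed
  qed
  have "successively (before v) (0 # u)"
    unfolding successively_conv_nth
  proof (intro allI impI)
    fix i assume "Suc i < length (0 # u)"
    then have "0 # u = take i (0 # u) @ (0 # u) ! i # (0 # u) ! Suc i # drop (Suc (Suc i)) (0 # u)"
      by (metis Cons_nth_drop_Suc Suc_lessD append_take_drop_id)
    then show "before v ((0 # u) ! i) ((0 # u) ! Suc i)" by (rule adj)
  qed
  moreover have "transp (before v)" using before_trans[OF v] by (auto intro: transpI)
  ultimately have srt: "sorted_wrt (before v) (0 # u)"
    by (simp add: successively_conv_sorted_wrt)
  \<comment> \<open>The entries after \<open>0\<close> are the letters of \<open>v\<close>, so \<open>u\<close> has the same letters.\<close>
  have mem: "a \<in> set v \<longleftrightarrow> before v 0 a" for a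
    using hyperoct_zero[OF v] by (auto simp: before_iff dest: prec_in_set)
  have sub': "set u \<subseteq> set v" using srt mem by auto
  have "set v \<subseteq> set u"
  proof
    fix a assume a: "a \<in> set v"
    then have "a \<noteq> 0" using hyperoct_zero[OF v] by auto
    then show "a \<in> set u"
      using a sub' hyperoct_mem_iff[OF v, of a] hyperoct_mem_iff[OF u, of a] by blast
  qed
  moreover have "prec v a b" if "prec u a b" for a b
  proof -
    have "before v a b" using srt that by (simp add: sorted_wrt_iff_prec)
    moreover have "a \<in> set v" "b \<in> set v" using sub' prec_in_set[OF that] by auto
    moreover have "a \<noteq> 0" "b \<noteq> 0" "- a \<notin> set v" "- b \<notin> set v"
      using calculation(2,3) hyperoct_zero[OF v] hyperoct_mem_iff[OF v] by metis+
    ultimately show ?thesis by (auto simp: before_iff dest: prec_in_set)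
  qed
  ultimately have "u = v"
    using sub' by (intro eq_if_prec_le distinct_hyperoct[OF u] distinct_hyperoct[OF v]) auto
  then show False using ne by simp
qed

text \<open>The inversions of \<open>v\<close> missing from \<open>u\<close> decrease in number along the steps provided by
  \<open>exists_weak_step\<close>.\<close>

theorem weak_le_iff_inversions:
  assumes "u \<in> hyperoct n" "v \<in> hyperoct n"
  shows "weak_le n u v \<longleftrightarrow> inversions u \<subseteq> inversions v"
proof
  assume "inversions u \<subseteq> inversions v"
  with assms(1) show "weak_le n u v"
  proof (induction "card (inversions v - inversions u)" arbitrary: u rule: less_induct)
    case less
    show ?case
    proof (cases "u = v")
      case True
      then show ?thesis using assms by (simp add: weak_le_def)
    next
      case False
      then obtain u' where u': "weak_step u u'" "inversions u' \<subseteq> inversions v" "inversions u \<noteq> inversions u'"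
        using exists_weak_step[OF less.prems(1) assms(2) less.prems(2)] by metis
      have "inversions u \<subset> inversions u'" using u' weak_step_inversions by blast
      then have "inversions v - inversions u' \<subset> inversions v - inversions u" using u'(2) by blast
      then have "card (inversions v - inversions u') < card (inversions v - inversions u)"
        using finite_inversions[OF assms(2)] by (simp add: psubset_card_mono)
      moreover have h: "u' \<in> hyperoct n" using u'(1) less.prems(1) by (rule weak_step_hyperoct)
      ultimately have "weak_le n u' v" using less.hyps u'(2) by blast
      moreover have "weak_cover n u u'" using less.prems(1) h u'(1) by (simp add: weak_cover_def)
      ultimately show ?thesis
        using less.prems(1) by (auto simp: weak_le_def intro: converse_rtranclp_into_rtranclp)
    qed
  qed
qed (rule weak_le_inversions)

section \<open>Pairs and their bits\<close>

text \<open>The symmetric record of \<open>A\<close>: the position of the letter \<open>j\<close> relative to the block \<open>A\<close> and its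
  mirror image, with \<open>0\<close> for the letters between these two blocks.\<close>

definition side :: "int set \<Rightarrow> int \<Rightarrow> int" where
  "side A j = of_bool (j \<in> A) - of_bool (- j \<in> A)"

text \<open>The value of \<open>side A\<close> from which on a letter stands after \<open>n\<close>. For positive \<open>n\<close> these are the
  letters of \<open>A\<close>; for negative \<open>n\<close> the letter \<open>n\<close> of the full word lies in the mirrored half,
  and all letters but those of \<open>- A\<close> follow it.\<close>

definition level :: "int \<Rightarrow> int" where
  "level e = (if e = 1 then 1 else 0)"

definition valid_code :: "nat \<Rightarrow> int \<times> int set \<Rightarrow> bool" where
  "valid_code n = (\<lambda>(e, A). (e = 1 \<or> e = - 1) \<and> (\<forall>a\<in>A. \<bar>a\<bar> < int n \<and> - a \<notin> A))"

lemma side_uminus: "side A (- j) = - side A j"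
  by (simp add: side_def)

lemma side_range: "- 1 \<le> side A j" "side A j \<le> 1"
  by (auto simp: side_def)

lemma side_zero: "side A 0 = 0"
  by (simp add: side_def)

lemma valid_codeD:
  assumes "valid_code n (e, A)"
  shows "e = 1 \<or> e = - 1" "a \<in> A \<Longrightarrow> \<bar>a\<bar> < int n" "a \<in> A \<Longrightarrow> - a \<notin> A" "0 \<notin> A"
  using assms by (force simp: valid_code_def)+

lemma mem_iff_side:
  assumes "valid_code n (e, A)"
  shows "a \<in> A \<longleftrightarrow> side A a = 1" "- a \<in> A \<longleftrightarrow> side A a = - 1"
  using valid_codeD(3)[OF assms, of a] valid_codeD(3)[OF assms, of "- a"] by (auto simp: side_def)

text \<open>At \<open>j = 0\<close> this is the sign bit, so that one formula covers all bits of the valuation.\<close>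

lemma bit_pair_eq:
  assumes "valid_code n (e, A)"
  shows "bit_pair (e, A) j = of_bool (level e \<le> side A j)"
proof -
  have "\<bar>j\<bar> \<in> abs ` A \<longleftrightarrow> j \<in> A \<or> - j \<in> A"
    by (auto simp: image_iff abs_eq_iff) (metis minus_minus)+
  then show ?thesis
    using valid_codeD(1)[OF assms] valid_codeD(3)[OF assms, of j] valid_codeD(3)[OF assms, of "- j"]
    by (auto simp: bit_pair_def side_def level_def)
qed

lemma hyperoct_split:
  assumes "n \<ge> 1" "w \<in> hyperoct n"
  obtains e L R where "w = L @ e * int n # R" "e = 1 \<or> e = - 1"
    "\<And>a. a \<in> set L \<union> set R \<Longrightarrow> \<bar>a\<bar> \<noteq> int n"
proof -
  have "int n \<in> abs ` set w" using assms by (auto simp: hyperoct_def)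
  then obtain c where c: "c \<in> set w" "\<bar>c\<bar> = int n" by auto
  then obtain L R where w: "w = L @ c # R" by (meson split_list)
  have "int n \<notin> abs ` set L \<union> abs ` set R"
    using assms(2) c(2) by (auto simp only: w hyperoct_def mem_Collect_eq list.map map_append distinct_append distinct.simps set_map set_append list.set Un_iff Int_iff insert_iff image_iff)
  then have "\<bar>a\<bar> \<noteq> int n" if "a \<in> set L \<union> set R" for a
    using that by (metis UnE UnI1 UnI2 imageI)
  moreover have "c = 1 * int n \<or> c = - 1 * int n" using c(2) by auto
  ultimately show ?thesis using w that by metis
qed

lemma word_code_split:
  assumes "n \<ge> 1" "e = 1 \<or> e = - 1" "\<And>a. a \<in> set L \<union> set R \<Longrightarrow> \<bar>a\<bar> \<noteq> int n"
  shows "word_code n (L @ e * int n # R) = (e, set R)"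
proof -
  have "dropWhile (\<lambda>a. \<bar>a\<bar> \<noteq> int n) (L @ e * int n # R) = e * int n # R"
    using assms by (subst dropWhile_append2) auto
  moreover have "int n \<in> set (L @ e * int n # R) \<longleftrightarrow> e = 1"
    using assms(1,2) assms(3)[of "int n"] by auto
  ultimately show ?thesis
    using assms(2) by (auto simp: word_code_def)
qed

text \<open>The means by which words with a prescribed pair are written down.\<close>

lemma hyperoct_splitI:
  assumes "n \<ge> 1" "e = 1 \<or> e = - 1" "distinct (map abs (L @ R))" "abs ` set (L @ R) = {1..int n - 1}"
  shows "L @ e * int n # R \<in> hyperoct n"
    and "word_code n (L @ e * int n # R) = (e, set R)"
    and "del n (L @ e * int n # R) = L @ R"
proof -
  have e: "\<bar>e * int n\<bar> = int n" using assms(2) by auto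
  have *: "\<bar>a\<bar> \<noteq> int n" if "a \<in> set L \<union> set R" for a
  proof -
    have "\<bar>a\<bar> \<in> {1..int n - 1}" using that assms(4) by (metis imageI set_append)
    then show ?thesis by auto
  qed
  show "word_code n (L @ e * int n # R) = (e, set R)"
    using assms(1,2) * by (rule word_code_split)
  have 1: "abs ` set (L @ e * int n # R) = insert (int n) (abs ` set (L @ R))"
    using e by auto
  have "abs ` set (L @ e * int n # R) = {1..int n}"
    unfolding 1 assms(4) using assms(1) by auto
  moreover have "distinct (map abs (L @ e * int n # R))"
  proof -
    have "int n \<notin> abs ` set (L @ R)" unfolding assms(4) by auto
    then show ?thesis using assms(3) e by auto
  qed
  ultimately show "L @ e * int n # R \<in> hyperoct n" by (simp only: hyperoct_def mem_Collect_eq)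
  show "del n (L @ e * int n # R) = L @ R"
    using * e by (simp add: del_def)
qed

text \<open>The bits of a pair are the inversions of its words that involve the letter of absolute value
  \<open>n\<close>.\<close>

lemma before_top_iff:
  assumes "n \<ge> 1" "w \<in> hyperoct n" "word_code n w = (e, A)" "\<bar>j\<bar> < int n"
  shows "before w (int n) j \<longleftrightarrow> level e \<le> side A j"
proof -
  obtain e' L R where w: "w = L @ e' * int n # R" and e': "e' = 1 \<or> e' = - 1"
    and LR: "\<And>a. a \<in> set L \<union> set R \<Longrightarrow> \<bar>a\<bar> \<noteq> int n"
    using hyperoct_split[OF assms(1,2)] by metis
  have "word_code n w = (e', set R)" unfolding w using assms(1) e' LR by (rule word_code_split)
  then have eA: "e' = e" "A = set R" using assms(3) by auto
  have nL: "int n \<notin> set L" "- int n \<notin> set L" "int n \<notin> set R" "- int n \<notin> set R"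
    using LR[of "int n"] LR[of "- int n"] by auto
  have pr: "\<not> prec L x y \<and> \<not> prec R x y" if "\<bar>x\<bar> = int n \<or> \<bar>y\<bar> = int n" for x y
    using that LR[of x] LR[of y] prec_in_set[of L x y] prec_in_set[of R x y] by blast
  have jn: "j \<noteq> int n" "j \<noteq> - int n" "- j \<noteq> int n" "int n \<noteq> 0" using assms(1,4) by auto
  have m: "j \<in> set w \<longleftrightarrow> j \<in> set L \<or> j \<in> set R" "- j \<in> set w \<longleftrightarrow> - j \<in> set L \<or> - j \<in> set R"
    using jn e' by (auto simp: w)
  show ?thesis
  proof (cases "e = 1")
    case True
    have "before w (int n) j \<longleftrightarrow> j \<in> set R"
      using nL pr[of "- j" "- int n"] pr[of "int n" j] jn
      by (auto simp: before_iff w prec_append True eA)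
    moreover have "- j \<notin> set R \<or> j \<notin> set R"
      using m hyperoct_mem_iff[OF assms(2), of j] hyperoct_zero[OF assms(2)] by (cases "j = 0") auto
    ultimately show ?thesis using True by (auto simp: side_def level_def eA)
  next
    case False
    then have e: "e = - 1" using e' eA by simp
    have "before w (int n) j \<longleftrightarrow> - j \<in> set L \<or> j \<in> set w \<or> j = 0"
      using nL pr[of "- j" "- int n"] pr[of "int n" j] jn
      by (auto simp: before_iff w prec_append e eA)
    moreover have "j = 0 \<or> (j \<in> set w \<longleftrightarrow> - j \<notin> set w)"
      using hyperoct_mem_iff[OF assms(2), of j] assms(4) by auto
    moreover have "0 \<notin> set w" by (rule hyperoct_zero[OF assms(2)])
    moreover have "\<not> (- j \<in> set L \<and> - j \<in> set R)"
      using distinct_hyperoct[OF assms(2)] by (auto simp: w)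
    ultimately show ?thesis using m False by (auto simp: side_def level_def eA)
  qed
qed

lemma valid_word_code:
  assumes "n \<ge> 1" "w \<in> hyperoct n"
  shows "valid_code n (word_code n w)"
proof -
  obtain e L R where w: "w = L @ e * int n # R" and e: "e = 1 \<or> e = - 1"
    and LR: "\<And>a. a \<in> set L \<union> set R \<Longrightarrow> \<bar>a\<bar> \<noteq> int n"
    using hyperoct_split[OF assms] by metis
  have c: "word_code n w = (e, set R)" unfolding w using assms(1) e LR by (rule word_code_split)
  have "\<bar>a\<bar> < int n \<and> - a \<notin> set R" if "a \<in> set R" for a
  proof -
    have "a \<in> set w" using that by (simp add: w)
    moreover from this have "\<bar>a\<bar> \<le> int n" by (rule hyperoct_le[OF assms(2)])
    moreover have "- a \<notin> set w"
      using calculation(1) hyperoct_mem_iff[OF assms(2), of a] hyperoct_zero[OF assms(2)] by metis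
    moreover have "\<bar>a\<bar> \<noteq> int n" using LR that by blast
    ultimately show ?thesis by (simp add: w)
  qed
  then show ?thesis using e by (simp add: c valid_code_def)
qed

section \<open>Words with the same pair lie in the same class\<close>

lemma hrel_refl: "w \<in> hyperoct n \<Longrightarrow> (w, w) \<in> hrel n"
  by (simp add: hrel_def)

lemma hrel_sym: "(v, w) \<in> hrel n \<Longrightarrow> (w, v) \<in> hrel n"
  by (simp add: hrel_def equivclp_sym)

lemma hrel_trans: "(u, v) \<in> hrel n \<Longrightarrow> (v, w) \<in> hrel n \<Longrightarrow> (u, w) \<in> hrel n"
  by (auto simp: hrel_def intro: equivclp_trans)

lemma hrel_hyperoct: "(v, w) \<in> hrel n \<Longrightarrow> v \<in> hyperoct n \<and> w \<in> hyperoct n"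
  by (simp add: hrel_def)

text \<open>Since deletion preserves the set of signed permutations, it is enough to exhibit steps in both
  words; membership comes for free.\<close>

lemma hrel_step:
  assumes "n \<ge> 1" "v \<in> hyperoct n" "weak_step v w" "weak_step (del n v) (del n w)"
  shows "(v, w) \<in> hrel n"
proof -
  have w: "w \<in> hyperoct n" using assms(2,3) by (metis weak_step_hyperoct)
  have "horizontal_cover n v w"
    using assms w del_hyperoct[OF assms(1)] unfolding horizontal_cover_def weak_cover_def by blast
  then show ?thesis using assms(2) w by (auto simp: hrel_def)
qed

text \<open>Which of the two words is the lower one does not matter for the generated equivalence.\<close>

lemma hrel_swap:
  assumes "n \<ge> 1" "xs @ a # b # ys \<in> hyperoct n" "\<bar>a\<bar> \<noteq> int n" "\<bar>b\<bar> \<noteq> int n"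
  shows "(xs @ a # b # ys, xs @ b # a # ys) \<in> hrel n"
proof -
  have *: "(xs @ a # b # ys, xs @ b # a # ys) \<in> hrel n"
    if "a < b" "xs @ a # b # ys \<in> hyperoct n" "\<bar>a\<bar> \<noteq> int n" "\<bar>b\<bar> \<noteq> int n" for a b
    using assms(1) that by (intro hrel_step) (auto simp: del_def intro: weak_step.swap)
  have "xs @ b # a # ys \<in> hyperoct n"
    using assms(2) by (auto simp: hyperoct_def insert_commute)
  moreover have "a \<noteq> b" using assms(2) by (auto simp: hyperoct_def)
  ultimately show ?thesis
    using *[of a b] *[of b a] assms(2-) hrel_sym by (metis linorder_neqE)
qed

lemma hrel_flip:
  assumes "n \<ge> 1" "a # ys \<in> hyperoct n" "\<bar>a\<bar> \<noteq> int n"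
  shows "(a # ys, \<bar>a\<bar> # ys) \<in> hrel n"
proof (cases "0 < a")
  case True
  then show ?thesis using assms by (simp add: hrel_refl)
next
  case False
  moreover have "a \<noteq> 0" using hyperoct_zero[OF assms(2)] by auto
  ultimately have "a < 0" by simp
  then have "weak_step (\<bar>a\<bar> # ys) (a # ys)" "weak_step (del n (\<bar>a\<bar> # ys)) (del n (a # ys))"
    using weak_step.flip[of "- a"] assms(3) by (simp_all add: del_def)
  moreover have "\<bar>a\<bar> # ys \<in> hyperoct n" using assms(2) by (auto simp: hyperoct_def)
  ultimately show ?thesis using assms(1) by (metis hrel_step hrel_sym)
qed

lemma hrel_move:
  assumes "n \<ge> 1" "xs @ ms @ a # ys \<in> hyperoct n" "\<bar>a\<bar> \<noteq> int n" "\<And>b. b \<in> set ms \<Longrightarrow> \<bar>b\<bar> \<noteq> int n"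
  shows "(xs @ ms @ a # ys, xs @ a # ms @ ys) \<in> hrel n"
  using assms
proof (induction ms arbitrary: xs)
  case Nil
  then show ?case by (simp add: hrel_refl)
next
  case (Cons m ms)
  have 1: "((xs @ [m]) @ ms @ a # ys, (xs @ [m]) @ a # ms @ ys) \<in> hrel n"
    using Cons.prems by (intro Cons.IH) auto
  then have "xs @ m # a # ms @ ys \<in> hyperoct n" using hrel_hyperoct by force
  then have "(xs @ m # a # ms @ ys, xs @ a # m # ms @ ys) \<in> hrel n"
    using Cons.prems by (intro hrel_swap) auto
  then show ?case using 1 hrel_trans by fastforce
qed

lemma hrel_permute:
  assumes "n \<ge> 1" "xs @ R @ ys \<in> hyperoct n" "distinct R'" "set R' = set R"
    "\<And>b. b \<in> set R \<Longrightarrow> \<bar>b\<bar> \<noteq> int n"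
  shows "(xs @ R @ ys, xs @ R' @ ys) \<in> hrel n"
  using assms
proof (induction R' arbitrary: xs R)
  case Nil
  then show ?case by (simp add: hrel_refl)
next
  case (Cons a R')
  have "a \<in> set R" using Cons.prems(4) by auto
  then obtain R1 R2 where R: "R = R1 @ a # R2" by (meson split_list)
  have d: "distinct R" using distinct_hyperoct[OF Cons.prems(2)] by simp
  have 1: "(xs @ R1 @ a # (R2 @ ys), xs @ a # R1 @ (R2 @ ys)) \<in> hrel n"
    using Cons.prems by (intro hrel_move) (auto simp: R)
  then have h: "(xs @ [a]) @ (R1 @ R2) @ ys \<in> hyperoct n" using hrel_hyperoct by force
  have "((xs @ [a]) @ (R1 @ R2) @ ys, (xs @ [a]) @ R' @ ys) \<in> hrel n"
  proof (rule Cons.IH)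
    show "set R' = set (R1 @ R2)" using Cons.prems(3,4) d by (auto simp: R)
  qed (use Cons.prems h R in auto)
  then show ?case using 1 hrel_trans by (fastforce simp: R)
qed

text \<open>Only the first letter can change its sign. So each letter in turn is carried to the front, made
  positive there, and carried back.\<close>

lemma hrel_abs:
  assumes "n \<ge> 1" "L @ ys \<in> hyperoct n" "\<And>b. b \<in> set L \<Longrightarrow> \<bar>b\<bar> \<noteq> int n"
  shows "(L @ ys, map abs L @ ys) \<in> hrel n"
  using assms
proof (induction L arbitrary: ys rule: rev_induct)
  case Nil
  then show ?case by (simp add: hrel_refl)
next
  case (snoc a L)
  have m1: "([] @ L @ a # ys, [] @ a # L @ ys) \<in> hrel n"
    using snoc.prems by (intro hrel_move) auto
  then have "a # L @ ys \<in> hyperoct n" using hrel_hyperoct by force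
  then have fl: "(a # L @ ys, \<bar>a\<bar> # L @ ys) \<in> hrel n"
    using snoc.prems by (intro hrel_flip) auto
  then have "L @ \<bar>a\<bar> # ys \<in> hyperoct n" using hrel_hyperoct[OF fl] by (auto simp: hyperoct_def)
  moreover from this have m2: "([] @ L @ \<bar>a\<bar> # ys, [] @ \<bar>a\<bar> # L @ ys) \<in> hrel n"
    using snoc.prems by (intro hrel_move) auto
  moreover have ih: "(L @ (\<bar>a\<bar> # ys), map abs L @ (\<bar>a\<bar> # ys)) \<in> hrel n"
    using snoc.prems calculation(1) by (intro snoc.IH) auto
  ultimately show ?case
    using hrel_trans[OF hrel_trans[OF m1[simplified] fl] hrel_trans[OF hrel_sym[OF m2[simplified]] ih]]
    by simp
qed

text \<open>Both words are related to one with the same letters left of \<open>n\<close>, all made positive; these are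
  the same set for both words, namely the absolute values not occurring elsewhere.\<close>

lemma hrel_if_same_code:
  assumes n: "n \<ge> 1" and v: "v \<in> hyperoct n" and w: "w \<in> hyperoct n"
    and eq: "word_code n v = word_code n w"
  shows "(v, w) \<in> hrel n"
proof -
  obtain e L R where v': "v = L @ e * int n # R" and e: "e = 1 \<or> e = - 1"
    and LR: "\<And>a. a \<in> set L \<union> set R \<Longrightarrow> \<bar>a\<bar> \<noteq> int n"
    using hyperoct_split[OF n v] by metis
  obtain e' L' R' where w': "w = L' @ e' * int n # R'" and e': "e' = 1 \<or> e' = - 1"
    and LR': "\<And>a. a \<in> set L' \<union> set R' \<Longrightarrow> \<bar>a\<bar> \<noteq> int n"
    using hyperoct_split[OF n w] by metis
  have "e' = e" "set R' = set R"
    using eq word_code_split[OF n e LR] word_code_split[OF n e' LR'] by (auto simp: v' w')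
  have 1: "(L @ (e * int n # R), map abs L @ (e * int n # R)) \<in> hrel n"
    using n v LR by (intro hrel_abs) (auto simp: v')
  have 2: "(L' @ (e * int n # R'), map abs L' @ (e * int n # R')) \<in> hrel n"
    using n w LR' \<open>e' = e\<close> by (intro hrel_abs) (auto simp: w')
  have h: "[] @ map abs L @ e * int n # R \<in> hyperoct n" using hrel_hyperoct[OF 1] by simp
  have abs_left: "abs ` set L = {1..int n} - {int n} - abs ` set R"
    if "L @ e * int n # R \<in> hyperoct n" for L R
  proof -
    have en: "\<bar>e * int n\<bar> = int n" using e by auto
    have "insert (int n) (abs ` set L \<union> abs ` set R) = {1..int n}"
      using that en by (auto simp: hyperoct_def)
    moreover have "abs ` set L \<inter> abs ` set R = {}" "int n \<notin> abs ` set L" 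
      using that en by (auto simp: hyperoct_def)
    ultimately show ?thesis by blast
  qed
  have "abs ` set L' = abs ` set L"
    using abs_left[of L R] abs_left[of L' R'] v w by (simp add: v' w' \<open>e' = e\<close> \<open>set R' = set R\<close>)
  moreover have "distinct (map abs L')" using w by (simp add: w' hyperoct_def)
  ultimately have 3: "([] @ map abs L @ (e * int n # R), [] @ map abs L' @ (e * int n # R)) \<in> hrel n"
    using n h LR by (intro hrel_permute) auto
  then have "(map abs L' @ [e * int n]) @ R @ [] \<in> hyperoct n" using hrel_hyperoct by force
  then have "((map abs L' @ [e * int n]) @ R @ [], (map abs L' @ [e * int n]) @ R' @ []) \<in> hrel n"
    using n LR distinct_hyperoct[OF w] \<open>set R' = set R\<close> by (intro hrel_permute) (auto simp: w')
  then have 4: "(map abs L' @ e * int n # R, map abs L' @ e * int n # R') \<in> hrel n" by simp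
  show ?thesis
    unfolding v' w' \<open>e' = e\<close>
    by (rule hrel_trans[OF hrel_trans[OF 1 3[unfolded append_Nil]] hrel_trans[OF 4 hrel_sym[OF 2]]])
qed

section \<open>The valuation compares bits lexicographically\<close>

definition has_bit :: "int \<times> int set \<Rightarrow> int \<Rightarrow> bool" where
  "has_bit x j \<longleftrightarrow> level (fst x) \<le> side (snd x) j"

definition binary :: "nat \<Rightarrow> (nat \<Rightarrow> bool) \<Rightarrow> nat" where
  "binary N p = (\<Sum>k<N. of_bool (p k) * 2 ^ k)"

lemma binary_less_power: "binary N p < 2 ^ N"
  by (induction N) (auto simp: binary_def)

lemma binary_less:
  assumes "k < N" "\<not> p k" "q k" "\<And>i. k < i \<Longrightarrow> i < N \<Longrightarrow> p i = q i"
  shows "binary N p < binary N q"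
  using assms
proof (induction N)
  case (Suc N)
  show ?case
  proof (cases "k = N")
    case True
    then show ?thesis using Suc.prems binary_less_power[of N p] by (simp add: binary_def)
  next
    case False
    then show ?thesis using Suc by (simp add: binary_def)
  qed
qed simp

text \<open>Gathers the three groups of summands in the definition of the valuation into one binary
  expansion, with the sign bit in the middle.\<close>

lemma sum_around:
  fixes g :: "nat \<Rightarrow> nat"
  shows "(\<Sum>i = 1..m. g (m - i)) + g m + (\<Sum>i = 1..m. g (m + i)) = sum g {..<2 * m + 1}"
proof -
  have "(\<Sum>i = 1..m. g (m - i)) = sum g {..<m}"
    by (rule sum.reindex_bij_witness[of _ "\<lambda>k. m - k" "\<lambda>i. m - i"]) auto
  moreover have "(\<Sum>i = 1..m. g (m + i)) = sum g {m<..<2 * m + 1}"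
    by (rule sum.reindex_bij_witness[of _ "\<lambda>k. k - m" "\<lambda>i. m + i"]) auto
  moreover have "sum g {..<2 * m + 1} = sum g ({..<m} \<union> {m} \<union> {m<..<2 * m + 1})"
    by (rule arg_cong[where f = "sum g"]) auto
  moreover have "\<dots> = sum g {..<m} + g m + sum g {m<..<2 * m + 1}"
    by (subst sum.union_disjoint; (subst sum.union_disjoint)?) auto
  ultimately show ?thesis by simp
qed

lemma val_eq_binary:
  assumes "n \<ge> 1" "valid_code n x"
  shows "val n x = binary (2 * n - 1) (\<lambda>k. has_bit x (int k - int (n - 1)))"
proof -
  obtain e A where x: "x = (e, A)" by fastforce
  have bit: "bit_pair x j = of_bool (has_bit x j)" for j
    using bit_pair_eq[of n e A j] assms(2) by (simp add: x has_bit_def)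
  have "bit_neg x = bit_pair x 0"
    using valid_codeD(4)[of n e A] assms(2) by (auto simp: x bit_neg_def bit_pair_def)
  then have neg: "bit_neg x = of_bool (has_bit x 0)" by (simp add: bit)
  define m where "m = n - 1"
  define g where "g = (\<lambda>k. of_bool (has_bit x (int k - int m)) * 2 ^ k :: nat)"
  have "val n x = (\<Sum>i = 1..m. g (m - i)) + g m + (\<Sum>i = 1..m. g (m + i))"
    unfolding val_def neg m_def[symmetric] by (simp add: bit g_def)
  also have "\<dots> = sum g {..<2 * m + 1}" by (rule sum_around)
  also have "2 * m + 1 = 2 * n - 1" using assms(1) by (simp add: m_def)
  finally show ?thesis by (simp add: binary_def g_def m_def)
qed

text \<open>Bit \<open>j\<close> has weight \<open>2 ^ (n - 1 + j)\<close>, which exceeds the sum of all lower weights.\<close>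

lemma val_less:
  assumes "n \<ge> 1" "valid_code n x" "valid_code n y" "\<bar>j\<bar> < int n" "\<not> has_bit x j" "has_bit y j"
    "\<And>i. j < i \<Longrightarrow> i < int n \<Longrightarrow> has_bit x i = has_bit y i"
  shows "val n x < val n y"
  unfolding val_eq_binary[OF assms(1,2)] val_eq_binary[OF assms(1,3)]
proof (rule binary_less)
  let ?k = "nat (j + int (n - 1))"
  have j: "int ?k - int (n - 1) = j" using assms(1,4) by auto
  show "?k < 2 * n - 1" using assms(1,4) by auto
  show "\<not> has_bit x (int ?k - int (n - 1))" "has_bit y (int ?k - int (n - 1))"
    unfolding j using assms by auto
  show "has_bit x (int i - int (n - 1)) = has_bit y (int i - int (n - 1))"
    if "?k < i" "i < 2 * n - 1" for i
    using that assms(1) by (intro assms(7)) auto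
qed

lemma top_difference:
  assumes "\<bar>i\<bar> < int n" "has_bit x i \<noteq> has_bit y i"
  obtains j where "\<bar>j\<bar> < int n" "has_bit x j \<noteq> has_bit y j"
    "\<And>i. j < i \<Longrightarrow> i < int n \<Longrightarrow> has_bit x i = has_bit y i"
proof -
  let ?D = "{i. \<bar>i\<bar> < int n \<and> has_bit x i \<noteq> has_bit y i}"
  have fin: "finite ?D" by (rule finite_subset[of _ "{- int n..int n}"]) auto
  have "i \<in> ?D" using assms by simp
  then have M: "Max ?D \<in> ?D" using fin Max_in by blast
  moreover have "has_bit x k = has_bit y k" if "Max ?D < k" "k < int n" for k
  proof (rule ccontr)
    assume "has_bit x k \<noteq> has_bit y k"
    then have "k \<in> ?D" using that M by auto
    then show False using that(1) Max_ge[OF fin, of k] by simp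
  qed
  ultimately show ?thesis using that by blast
qed

text \<open>The sign is read off from bit \<open>0\<close>. Given the sign, the bits \<open>a\<close> and \<open>- a\<close> together
  determine which of \<open>a\<close> and \<open>- a\<close>, if any, lies in \<open>A\<close>.\<close>

lemma code_eqI:
  assumes n: "n \<ge> 1" and x: "valid_code n x" and y: "valid_code n y"
    and eq: "\<And>i. \<bar>i\<bar> < int n \<Longrightarrow> has_bit x i = has_bit y i"
  shows "x = y"
proof -
  obtain e A where xe: "x = (e, A)" by fastforce
  obtain f B where ye: "y = (f, B)" by fastforce
  note X = valid_codeD[OF x[unfolded xe]] and Y = valid_codeD[OF y[unfolded ye]]
  have "e = f"
    using eq[of 0] n X(1) Y(1) by (auto simp: xe ye has_bit_def level_def side_zero)
  moreover have "a \<in> A \<longleftrightarrow> a \<in> B" for a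
  proof (cases "\<bar>a\<bar> < int n")
    case True
    have "has_bit x a = has_bit y a" "has_bit x (- a) = has_bit y (- a)"
      using eq[of a] eq[of "- a"] True by auto
    then show ?thesis
      using mem_iff_side(1)[OF x[unfolded xe], of a] mem_iff_side(1)[OF y[unfolded ye], of a]
        side_range[of A a] side_range[of B a]
      by (auto simp: xe ye has_bit_def side_uminus \<open>e = f\<close> level_def split: if_splits)
  qed (use X(2) Y(2) in auto)
  ultimately show ?thesis by (auto simp: xe ye)
qed

lemma val_inj:
  assumes "n \<ge> 1" "valid_code n x" "valid_code n y" "val n x = val n y"
  shows "x = y"
proof (rule code_eqI[OF assms(1-3)], rule ccontr)
  fix i assume "\<bar>i\<bar> < int n" "has_bit x i \<noteq> has_bit y i"
  then obtain j where j: "\<bar>j\<bar> < int n" "has_bit x j \<noteq> has_bit y j"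
    "\<And>i. j < i \<Longrightarrow> i < int n \<Longrightarrow> has_bit x i = has_bit y i"
    using top_difference by blast
  then show False
    using val_less[OF assms(1-3), of j] val_less[OF assms(1,3,2), of j] assms(4) by (cases "has_bit x j") auto
qed

lemma val_less_obtain:
  assumes "n \<ge> 1" "valid_code n x" "valid_code n y" "val n x < val n y"
  obtains j where "\<bar>j\<bar> < int n" "\<not> has_bit x j" "has_bit y j"
    "\<And>i. j < i \<Longrightarrow> i < int n \<Longrightarrow> has_bit x i = has_bit y i"
proof -
  have "x \<noteq> y" using assms(4) by auto
  then obtain i where "\<bar>i\<bar> < int n" "has_bit x i \<noteq> has_bit y i"
    using code_eqI[OF assms(1-3)] by blast
  then obtain j where j: "\<bar>j\<bar> < int n" "has_bit x j \<noteq> has_bit y j"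
    "\<And>i. j < i \<Longrightarrow> i < int n \<Longrightarrow> has_bit x i = has_bit y i"
    using top_difference by blast
  moreover have "has_bit y j"
    using val_less[OF assms(1,3,2), of j] j assms(4) by (cases "has_bit y j") auto
  ultimately show ?thesis using that by blast
qed

lemma val_mono:
  assumes "n \<ge> 1" "valid_code n x" "valid_code n y"
    "\<And>i. \<bar>i\<bar> < int n \<Longrightarrow> has_bit x i \<Longrightarrow> has_bit y i"
  shows "val n x \<le> val n y"
proof (rule ccontr)
  assume "\<not> ?thesis"
  then have "val n y < val n x" by simp
  then obtain j where "\<bar>j\<bar> < int n" "\<not> has_bit y j" "has_bit x j"
    using val_less_obtain[OF assms(1,3,2)] by metis
  then show False using assms(4) by blast
qed

section \<open>Edges never decrease the valuation\<close>

definition aux_pair :: "nat \<Rightarrow> int list \<Rightarrow> int list \<Rightarrow> bool" where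
  "aux_pair n v w \<longleftrightarrow> weak_less (n - 1) (del n w) (del n v) \<and> \<not> weak_le n v w \<and> \<not> weak_le n w v"

definition code_edge :: "nat \<Rightarrow> int \<times> int set \<Rightarrow> int \<times> int set \<Rightarrow> bool" where
  "code_edge n x y \<longleftrightarrow> (\<exists>v\<in>hyperoct n. \<exists>w\<in>hyperoct n.
     word_code n v = x \<and> word_code n w = y \<and> (vertical_cover n v w \<or> aux_pair n v w))"

lemma before_top_has_bit:
  assumes "n \<ge> 1" "w \<in> hyperoct n" "\<bar>j\<bar> < int n"
  shows "before w (int n) j \<longleftrightarrow> has_bit (word_code n w) j"
  using before_top_iff[OF assms(1,2) _ assms(3)] by (cases "word_code n w") (auto simp: has_bit_def)

text \<open>A missing inversion must involve the letter of absolute value \<open>n\<close>. By the symmetry of the full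
  word it can be taken with \<open>n\<close> in front; the inversion \<open>(n, - n)\<close> amounts to \<open>(n, 0)\<close>.\<close>

lemma inversions_top:
  assumes "n \<ge> 1" "v \<in> hyperoct n" "w \<in> hyperoct n"
    "inversions (del n w) \<subseteq> inversions (del n v)" "\<not> inversions w \<subseteq> inversions v"
  obtains j where "\<bar>j\<bar> < int n" "before w (int n) j" "\<not> before v (int n) j"
proof -
  obtain a b where ab: "b < a" "before w a b" "\<not> before v a b"
    using assms(5) by (auto simp: inversions_def)
  have le: "\<bar>a\<bar> \<le> int n" "\<bar>b\<bar> \<le> int n" using before_le[OF assms(3) ab(2)] by auto
  have "\<not> (\<bar>a\<bar> \<noteq> int n \<and> \<bar>b\<bar> \<noteq> int n)"
    using assms(4) ab by (auto simp: inversions_def before_del[OF assms(1)])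
  then consider "a = int n" "\<bar>b\<bar> < int n" | "b = - int n" "\<bar>a\<bar> < int n" | "a = int n" "b = - int n"
    using le ab(1) by linarith
  then show ?thesis
  proof cases
    case 1
    then show ?thesis using that[of b] ab by auto
  next
    case 2
    then show ?thesis using that[of "- a"] ab before_uminus[of _ "- int n" a] by (metis abs_minus_cancel before_uminus minus_minus)
  next
    case 3
    then show ?thesis using that[of 0] ab assms(1) before_uminus_self assms(2,3) by auto
  qed
qed

text \<open>If \<open>w\<close> has all the inversions of \<open>v\<close>, then it has all its bits. Otherwise the edge is auxiliary
  and \<open>w\<close> has a bit \<open>j\<close> that \<open>v\<close> lacks. A bit \<open>i > j\<close> of \<open>v\<close> that \<open>w\<close> lacks would make
  \<open>(i, j)\<close> an inversion of \<open>w\<close> and not of \<open>v\<close>, which survives the deletion. So the top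
  difference, which is at or above \<open>j\<close>, is a bit of \<open>w\<close>.\<close>

lemma code_edge_val_le:
  assumes n: "n \<ge> 1" and edge: "code_edge n x y"
  shows "val n x \<le> val n y"
proof -
  obtain v w where v: "v \<in> hyperoct n" and w: "w \<in> hyperoct n"
    and x: "x = word_code n v" and y: "y = word_code n w"
    and vw: "vertical_cover n v w \<or> aux_pair n v w"
    using edge by (auto simp: code_edge_def)
  have vx: "valid_code n x" and vy: "valid_code n y"
    using valid_word_code[OF n] v w by (auto simp: x y)
  note hx = before_top_has_bit[OF n v, folded x] and hy = before_top_has_bit[OF n w, folded y]
  show ?thesis
  proof (cases "inversions v \<subseteq> inversions w")
    case True
    show ?thesis
    proof (rule val_mono[OF n vx vy])
      fix i assume i: "\<bar>i\<bar> < int n" "has_bit x i"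
      then have "(int n, i) \<in> inversions v" using hx by (auto simp: inversions_def)
      then show "has_bit y i" using True hy i by (auto simp: inversions_def)
    qed
  next
    case False
    then have "aux_pair n v w"
      using vw weak_step_inversions by (auto simp: vertical_cover_def weak_cover_def)
    then have sub: "inversions (del n w) \<subseteq> inversions (del n v)" and "\<not> weak_le n w v"
      using weak_le_inversions by (auto simp: aux_pair_def weak_less_def)
    then have "\<not> inversions w \<subseteq> inversions v" using weak_le_iff_inversions[OF w v] by simp
    then obtain j where j: "\<bar>j\<bar> < int n" "before w (int n) j" "\<not> before v (int n) j"
      using inversions_top[OF n v w sub] by metis
    then have "has_bit x j \<noteq> has_bit y j" using hx hy by auto
    have *: "has_bit y i" if i: "\<bar>i\<bar> < int n" "has_bit x i" "\<not> has_bit y i" "j < i" for i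
    proof -
      have "before v (int n) i" "before w i (int n)" "before v j (int n)"
        using i j hx hy before_total[OF w, of i "int n"] before_total[OF v, of j "int n"] by auto
      then have "before w i j" "before v j i"
        using before_trans[OF w _ j(2)] before_trans[OF v] by blast+
      then have "(i, j) \<in> inversions (del n w)" "(i, j) \<notin> inversions (del n v)"
        using i j(1) before_asym[OF v] by (auto simp: inversions_def before_del[OF n])
      then show ?thesis using sub by blast
    qed
    obtain k where k: "\<bar>k\<bar> < int n" "has_bit x k \<noteq> has_bit y k"
      "\<And>i. k < i \<Longrightarrow> i < int n \<Longrightarrow> has_bit x i = has_bit y i"
      using top_difference[OF j(1) \<open>has_bit x j \<noteq> has_bit y j\<close>] by metis
    have "j \<le> k" using k(3)[of j] j(1) \<open>has_bit x j \<noteq> has_bit y j\<close> by force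
    have "\<not> has_bit x k"
    proof
      assume "has_bit x k"
      moreover have "k \<noteq> j" using j hx \<open>has_bit x k\<close> by auto
      ultimately show False using *[of k] k \<open>j \<le> k\<close> by auto
    qed
    then show ?thesis using val_less[OF n vx vy k(1)] k by auto
  qed
qed

section \<open>Auxiliary edges between extremal words\<close>

lemma valid_code_letters:
  assumes "valid_code n (e, A)"
  shows "abs ` A \<subseteq> {1..int n - 1}" "finite A" "inj_on abs A"
proof -
  note X = valid_codeD[OF assms]
  show 1: "abs ` A \<subseteq> {1..int n - 1}"
  proof (rule image_subsetI)
    fix a assume "a \<in> A"
    then have "\<bar>a\<bar> < int n" "a \<noteq> 0" using X(2,4) by metis+
    then show "\<bar>a\<bar> \<in> {1..int n - 1}" by simp
  qed
  show inj: "inj_on abs A" using X(3) by (auto simp: inj_on_def abs_eq_iff)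
  show "finite A" by (rule finite_imageD[OF finite_subset[OF 1] inj]) simp
qed

text \<open>Among the words with a given pair, those with the fewest inversions (\<open>s = 1\<close>) have positive increasing
  letters left of \<open>n\<close> and increasing letters right of it; those with the most inversions
  (\<open>s = - 1\<close>) have negative decreasing letters left of \<open>n\<close> and decreasing ones right of it. In
  either case, among the letters other than \<open>n\<close>, only pairs in different blocks of the full word, which \<open>side A\<close> tells
  apart, can stand in the order that \<open>s\<close> opposes.\<close>

lemma exists_extremal_word:
  assumes n: "n \<ge> 1" and x: "valid_code n (e, A)" and s: "s = 1 \<or> s = - (1 :: int)"
  obtains w where "w \<in> hyperoct n" "word_code n w = (e, A)"
    "\<And>a b. \<bar>a\<bar> < int n \<Longrightarrow> \<bar>b\<bar> < int n \<Longrightarrow> s * b < s * a \<Longrightarrow> before w a b \<Longrightarrow> side A a < side A b"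
proof -
  note X = valid_codeD[OF x]
  note fin = valid_code_letters(2)[OF x]
  have ss: "s * s = 1" "s * (s * a) = a" for a using s by auto
  define C where "C = {1..int n - 1} - abs ` A"
  define L where "L = map (\<lambda>c. s * c) (sorted_list_of_set C)"
  define R where "R = map (\<lambda>a. s * a) (sorted_list_of_set ((\<lambda>a. s * a) ` A))"
  have finC: "finite C" by (simp add: C_def)
  have setL: "set L = (\<lambda>c. s * c) ` C" using finC by (simp add: L_def)
  have setR: "set R = A" using fin s by (auto simp: R_def image_image)
  have sortL: "sorted_wrt (\<lambda>a b. s * a < s * b) L"
    using strict_sorted_list_of_set[of C] by (simp add: L_def sorted_wrt_map ss)
  have sortR: "sorted_wrt (\<lambda>a b. s * a < s * b) R"
    using strict_sorted_list_of_set[of "(\<lambda>a. s * a) ` A"] by (simp add: R_def sorted_wrt_map ss)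
  have absL: "abs ` set L = C"
  proof -
    have "\<bar>s * c\<bar> = c" if "c \<in> C" for c using that s by (auto simp: C_def)
    then show ?thesis by (simp add: setL image_image)
  qed
  note valid_code_letters(3)[OF x]
  moreover have "inj_on abs (set L)"
    using s by (auto simp: setL inj_on_def C_def)
  moreover have "distinct L" "distinct R"
    using s by (auto simp: L_def R_def distinct_map inj_on_def)
  moreover have "abs ` set L \<inter> abs ` set R = {}" unfolding absL setR by (auto simp: C_def)
  ultimately have d: "distinct (map abs (L @ R))" 
    by (simp add: distinct_map setR)
  have cov: "abs ` set (L @ R) = {1..int n - 1}"
    unfolding set_append image_Un absL setR using valid_code_letters(1)[OF x] by (auto simp: C_def)
  note W = hyperoct_splitI[OF n X(1) d cov]
  have L0: "side A c = 0 \<and> 0 < s * c" if "c \<in> set L" for c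
  proof -
    obtain d where d: "c = s * d" "d \<in> C" using \<open>c \<in> set L\<close> setL by auto
    then have "\<bar>c\<bar> \<notin> abs ` A" "0 < s * c" using s by (auto simp: C_def)
    then show ?thesis by (auto simp: side_def image_iff)
  qed
  have R1: "side A a = 1" if "a \<in> set R" for a
    using that mem_iff_side(1)[OF x] by (simp add: setR)
  have prec: "side A a < side A b" if "prec (L @ R) a b" "s * b < s * a" for a b
  proof -
    have "\<not> prec L a b" "\<not> prec R a b"
      using sortL sortR that(2) unfolding sorted_wrt_iff_prec by fastforce+
    then show ?thesis using that(1) L0 R1 by (auto simp: prec_append)
  qed
  have "side A a < side A b"
    if "\<bar>a\<bar> < int n" "\<bar>b\<bar> < int n" and ba: "s * b < s * a" and bef: "before (L @ e * int n # R) a b" for a b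
  proof -
    have "before (L @ R) a b"
      using before_del[OF n, of "L @ e * int n # R" a b] that by (simp add: W(3))
    then consider "prec (L @ R) (- b) (- a)" | "prec (L @ R) a b"
      | "- a \<in> set (L @ R)" "b \<in> set (L @ R)" | "a = 0" "b \<in> set (L @ R)" | "b = 0" "- a \<in> set (L @ R)"
      by (auto simp: before_iff)
    then show ?thesis
    proof cases
      case 1
      then show ?thesis using prec[of "- b" "- a"] ba by (simp add: side_uminus)
    next
      case 2
      then show ?thesis using prec ba by blast
    next
      case 3
      then show ?thesis
        using L0[of "- a"] L0[of b] R1[of "- a"] R1[of b] ba by (auto simp: side_uminus)
    next
      case 4
      then show ?thesis using L0[of b] R1[of b] ba by (auto simp: side_zero)
    next
      case 5
      then show ?thesis using L0[of "- a"] R1[of "- a"] ba by (auto simp: side_uminus side_zero)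
    qed
  qed
  then show ?thesis using that[OF W(1)] W(2) setR by blast
qed

text \<open>Take the most inverted word \<open>v\<close> of the first pair and the least inverted word \<open>w\<close> of the
  second. Inversions of \<open>w\<close> without \<open>n\<close> come only from \<open>side B a < side B b\<close>, and noninversions
  of \<open>v\<close> only from \<open>side A b < side A a\<close>; the first hypothesis excludes that both happen at once. The letter \<open>i\<close>
  is negative in \<open>v\<close> and positive in \<open>w\<close>, which makes the containment strict, and the bit \<open>j\<close>
  keeps \<open>w\<close> from being below \<open>v\<close>.\<close>

lemma code_edge_aux:
  assumes n: "n \<ge> 1" and x: "valid_code n (e, A)" and y: "valid_code n (f, B)"
    and mono: "\<And>a b. \<bar>a\<bar> < int n \<Longrightarrow> \<bar>b\<bar> < int n \<Longrightarrow> b < a \<Longrightarrow> side B a < side B b \<Longrightarrow> side A a \<le> side A b"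
    and i: "0 < i" "i < int n" "side A i \<le> 0" "0 \<le> side B i"
    and j: "\<bar>j\<bar> < int n" "\<not> has_bit (e, A) j" "has_bit (f, B) j"
  shows "code_edge n (e, A) (f, B)"
proof -
  obtain v where v: "v \<in> hyperoct n" "word_code n v = (e, A)"
    and v': "\<And>a b. \<bar>a\<bar> < int n \<Longrightarrow> \<bar>b\<bar> < int n \<Longrightarrow> a < b \<Longrightarrow> before v a b \<Longrightarrow> side A a < side A b"
    using exists_extremal_word[OF n x, of "- 1"] by auto
  obtain w where w: "w \<in> hyperoct n" "word_code n w = (f, B)"
    and w': "\<And>a b. \<bar>a\<bar> < int n \<Longrightarrow> \<bar>b\<bar> < int n \<Longrightarrow> b < a \<Longrightarrow> before w a b \<Longrightarrow> side B a < side B b"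
    using exists_extremal_word[OF n y, of 1] by auto
  have sub: "inversions (del n w) \<subseteq> inversions (del n v)"
  proof (clarsimp simp: inversions_def)
    fix a b assume ab: "b < a" "before (del n w) a b"
    then have le: "\<bar>a\<bar> < int n" "\<bar>b\<bar> < int n"
      using before_le[OF del_hyperoct[OF n w(1)] ab(2)] n by auto
    then have "side A a \<le> side A b"
      using mono ab w' before_del[OF n] by blast
    then have "\<not> before v b a" using v'[of b a] le ab(1) by fastforce
    then show "before (del n v) a b"
      using before_total[OF v(1), of a b] le ab(1) before_del[OF n] by auto
  qed
  have bi: "before v i 0" "\<not> before w i 0"
    using v'[of 0 i] w'[of i 0] i before_total[OF v(1), of 0 i] by (auto simp: side_zero)
  then have nsub: "(i, 0) \<in> inversions (del n v)" "(i, 0) \<notin> inversions (del n w)" "(i, 0) \<in> inversions v" "(i, 0) \<notin> inversions w"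
    using i before_del[OF n] by (auto simp: inversions_def)
  have "before w (int n) j" "\<not> before v (int n) j"
    using before_top_has_bit[OF n v(1) j(1)] before_top_has_bit[OF n w(1) j(1)] j v w by auto
  then have "(int n, j) \<in> inversions w" "(int n, j) \<notin> inversions v"
    using j(1) by (auto simp: inversions_def)
  then have "aux_pair n v w"
    using nsub sub v(1) w(1) del_hyperoct[OF n]
    unfolding aux_pair_def weak_less_def by (auto simp: weak_le_iff_inversions simp del: One_nat_def)
  then show ?thesis using v w by (auto simp: code_edge_def)
qed

section \<open>Vertical edges\<close>

text \<open>\<open>C\<close> consists of the absolute values of the letters left of \<open>n\<close> in any word with the given pair; taken positive,
  they form a possible left part.\<close>

lemma exists_complement:
  assumes "valid_code n (e, A)"
  obtains C where "finite C" "C \<inter> abs ` A = {}" "C \<union> abs ` A = {1..int n - 1}" "inj_on abs C"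
    "\<And>S. S \<subseteq> C \<Longrightarrow> abs ` S = S"
proof -
  let ?C = "{1..int n - 1} - abs ` A"
  have "abs ` S = S" if S: "S \<subseteq> ?C" for S
  proof -
    have "abs c = c" if "c \<in> S" for c using that S by auto
    then have "abs ` S = id ` S" by (intro image_cong) auto
    then show ?thesis by simp
  qed
  moreover have "?C \<union> abs ` A = {1..int n - 1}"
    using valid_code_letters(1)[OF assms] by blast
  ultimately show ?thesis by (intro that[of ?C]) (auto simp: inj_on_def)
qed

text \<open>Choose a word in which \<open>k\<close> is the last letter before \<open>n\<close>, and exchange the two.\<close>

lemma code_edge_insert:
  assumes n: "n \<ge> 1" and x: "valid_code n (1, A)" and k: "\<bar>k\<bar> < int n" "k \<noteq> 0" "side A k = 0"
  shows "code_edge n (1, A) (1, insert k A)" "valid_code n (1, insert k A)"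
proof -
  note X = valid_codeD[OF x]
  have kA: "k \<notin> A" "- k \<notin> A" using k(3) mem_iff_side[OF x, of k] by auto
  then have kA': "\<bar>k\<bar> \<notin> abs ` A" by (auto simp: image_iff abs_eq_iff)
  show "valid_code n (1, insert k A)" using x kA k by (auto simp: valid_code_def)
  obtain C where C: "finite C" "C \<inter> abs ` A = {}" "C \<union> abs ` A = {1..int n - 1}" "inj_on abs C"
    "\<And>S. S \<subseteq> C \<Longrightarrow> abs ` S = S"
    using exists_complement[OF x] by metis
  note A = valid_code_letters[OF x]
  obtain L where L: "set L = C - {\<bar>k\<bar>}" "distinct L" using finite_distinct_list C(1) by (metis finite_Diff)
  obtain R where R: "set R = A" "distinct R" using finite_distinct_list A(2) by metis
  have kC: "\<bar>k\<bar> \<in> C"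
  proof -
    have "\<bar>k\<bar> \<in> C \<union> abs ` A" unfolding C(3) using k(1,2) by auto
    then show ?thesis using kA' by blast
  qed
  have absL: "abs ` set L = C - {\<bar>k\<bar>}" unfolding L(1) by (rule C(5)) auto
  have d: "distinct (map abs L)" "distinct (map abs R)"
    using L R A(3) inj_on_subset[OF C(4)] by (auto simp: distinct_map)
  have 1: "distinct (map abs ((L @ [k]) @ R))" "abs ` set ((L @ [k]) @ R) = {1..int n - 1}"
  proof -
    have "insert \<bar>k\<bar> (abs ` set L) \<inter> abs ` set R = {}"
      unfolding absL R(1) using kA' C(2) by blast
    then show "distinct (map abs ((L @ [k]) @ R))"
      using d absL by auto
    have "abs ` set ((L @ [k]) @ R) = insert \<bar>k\<bar> (abs ` set L) \<union> abs ` A" using R(1) by auto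
    also have "\<dots> = C \<union> abs ` A" unfolding absL using kC by blast
    finally show "abs ` set ((L @ [k]) @ R) = {1..int n - 1}" unfolding C(3) .
  qed
  have 2: "distinct (map abs (L @ (k # R)))" "abs ` set (L @ (k # R)) = {1..int n - 1}"
    using 1 by auto
  note W1 = hyperoct_splitI[OF n _ 1, of 1] and W2 = hyperoct_splitI[OF n _ 2, of 1]
  have "weak_step (L @ k # int n # R) (L @ int n # k # R)"
    using k by (intro weak_step.swap) auto
  then have "vertical_cover n ((L @ [k]) @ 1 * int n # R) (L @ 1 * int n # (k # R))"
    using W1 W2 unfolding vertical_cover_def weak_cover_def by simp
  then show "code_edge n (1, A) (1, insert k A)"
    using W1(1,2) W2(1,2) R(1) unfolding code_edge_def by fastforce
qed

text \<open>Choose a word in which \<open>k\<close> is the first letter after \<open>- n\<close>, and exchange the two.\<close>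

lemma code_edge_remove:
  assumes n: "n \<ge> 1" and x: "valid_code n (- 1, A)" and k: "k \<in> A"
  shows "code_edge n (- 1, A) (- 1, A - {k})" "valid_code n (- 1, A - {k})"
proof -
  note X = valid_codeD[OF x]
  show "valid_code n (- 1, A - {k})" using x by (auto simp: valid_code_def)
  obtain C where C: "finite C" "C \<inter> abs ` A = {}" "C \<union> abs ` A = {1..int n - 1}" "inj_on abs C"
    "\<And>S. S \<subseteq> C \<Longrightarrow> abs ` S = S"
    using exists_complement[OF x] by metis
  note A = valid_code_letters[OF x]
  obtain L where L: "set L = C" "distinct L" using finite_distinct_list C(1) by metis
  obtain R where R: "set R = A - {k}" "distinct R" using finite_distinct_list A(2) by (metis finite_Diff)
  have absL: "abs ` set L = C" unfolding L(1) by (rule C(5)) simp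
  have d: "distinct (map abs L)" "distinct (map abs (k # R))"
    using L R A(3) C(4) k by (auto simp: distinct_map inj_on_def)
  have 1: "distinct (map abs (L @ (k # R)))" "abs ` set (L @ (k # R)) = {1..int n - 1}"
  proof -
    have s: "set (k # R) = A" using R(1) k by auto
    have "abs ` set L \<inter> abs ` set (k # R) = {}" unfolding s absL by (rule C(2))
    then show "distinct (map abs (L @ (k # R)))"
      using d unfolding map_append distinct_append set_map by blast
    show "abs ` set (L @ (k # R)) = {1..int n - 1}"
      unfolding set_append image_Un s absL by (rule C(3))
  qed
  then have 2: "distinct (map abs ((L @ [k]) @ R))" "abs ` set ((L @ [k]) @ R) = {1..int n - 1}"
    by auto
  note W1 = hyperoct_splitI[OF n _ 1, of "- 1"] and W2 = hyperoct_splitI[OF n _ 2, of "- 1"]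
  have "weak_step (L @ - int n # k # R) (L @ k # - int n # R)"
    using X(2)[OF k] by (intro weak_step.swap) auto
  then have "vertical_cover n (L @ - 1 * int n # (k # R)) ((L @ [k]) @ - 1 * int n # R)"
    using W1 W2 unfolding vertical_cover_def weak_cover_def by simp
  moreover have "set (k # R) = A" using R(1) k by auto
  ultimately show "code_edge n (- 1, A) (- 1, A - {k})"
    using W1(1,2) W2(1,2) R(1) unfolding code_edge_def by fastforce
qed

text \<open>The hypothesis says that every other letter stands to the right of \<open>n\<close>, so that \<open>n\<close> comes first
  and can change its sign.\<close>

lemma code_edge_flip:
  assumes n: "n \<ge> 1" and x: "valid_code n (1, A)"
    and full: "\<And>k. \<bar>k\<bar> < int n \<Longrightarrow> k \<noteq> 0 \<Longrightarrow> side A k \<noteq> 0"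
  shows "code_edge n (1, A) (- 1, A)" "valid_code n (- 1, A)"
proof -
  note X = valid_codeD[OF x]
  show "valid_code n (- 1, A)" using x by (auto simp: valid_code_def)
  obtain C where C: "finite C" "C \<inter> abs ` A = {}" "C \<union> abs ` A = {1..int n - 1}" "inj_on abs C"
    "\<And>S. S \<subseteq> C \<Longrightarrow> abs ` S = S"
    using exists_complement[OF x] by metis
  note A = valid_code_letters[OF x]
  have "C = {}"
  proof (rule equals0I)
    fix c assume c: "c \<in> C"
    then have "c \<in> {1..int n - 1}" using C(3) by blast
    then have "\<bar>c\<bar> < int n" "c \<noteq> 0" "\<bar>c\<bar> = c" by auto
    moreover have "\<bar>c\<bar> \<notin> abs ` A" using c C(2) calculation(3) by auto
    then have "c \<notin> A" "- c \<notin> A" by (metis imageI abs_minus_cancel)+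
    ultimately show False using full[of c] by (simp add: side_def)
  qed
  obtain R where R: "set R = A" "distinct R" using finite_distinct_list A(2) by metis
  have 1: "distinct (map abs ([] @ R))" "abs ` set ([] @ R) = {1..int n - 1}"
    using R A(3) C(3) \<open>C = {}\<close> by (auto simp: distinct_map)
  note W1 = hyperoct_splitI[OF n _ 1, of 1] and W2 = hyperoct_splitI[OF n _ 1, of "- 1"]
  have "weak_step (int n # R) (- int n # R)"
    using n by (intro weak_step.flip) auto
  then have "vertical_cover n ([] @ 1 * int n # R) ([] @ - 1 * int n # R)"
    using W1 W2 unfolding vertical_cover_def weak_cover_def by simp
  then show "code_edge n (1, A) (- 1, A)"
    using W1(1,2) W2(1,2) R(1) unfolding code_edge_def by fastforce
qed

text \<open>For positive \<open>n\<close> the letter \<open>k\<close> enters \<open>A\<close>, for negative \<open>n\<close> the letter \<open>- k\<close> leaves it.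
  In both cases \<open>side\<close> changes at \<open>- k\<close> too, but there it does not cross the level.\<close>

lemma code_edge_raise:
  assumes n: "n \<ge> 1" and x: "valid_code n (e, A)"
    and k: "\<bar>k\<bar> < int n" "k \<noteq> 0" "side A k = level e - 1"
  obtains z where "valid_code n z" "code_edge n (e, A) z" "z \<noteq> (e, A)"
    "\<And>j. has_bit z j \<longleftrightarrow> has_bit (e, A) j \<or> j = k"
proof (cases "e = 1")
  case True
  have kA: "k \<notin> A" "- k \<notin> A" using k(3) mem_iff_side[OF x, of k] by (auto simp: True level_def)
  show ?thesis
  proof (rule that)
    show "valid_code n (1, insert k A)" "code_edge n (e, A) (1, insert k A)"
      using code_edge_insert[OF n x[unfolded True] k(1,2)] k(3) by (simp_all add: True level_def)
    show "(1, insert k A) \<noteq> (e, A)" using kA by auto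
    show "has_bit (1, insert k A) j \<longleftrightarrow> has_bit (e, A) j \<or> j = k" for j
      using kA k(2) by (cases "j = k") (auto simp: has_bit_def True level_def side_def)
  qed
next
  case False
  have kA: "- k \<in> A" "k \<notin> A"
    using k(3) mem_iff_side[OF x, of k] by (auto simp: False level_def)
  have e: "e = - 1" using False valid_codeD(1)[OF x] by simp
  show ?thesis
  proof (rule that)
    show "valid_code n (- 1, A - {- k})" "code_edge n (e, A) (- 1, A - {- k})"
      using code_edge_remove[OF n x[unfolded e] kA(1)] by (simp_all add: e)
    show "(- 1, A - {- k}) \<noteq> (e, A)" using kA by auto
    show "has_bit (- 1, A - {- k}) j \<longleftrightarrow> has_bit (e, A) j \<or> j = k" for j
      using kA k(2) by (cases "j = k") (auto simp: has_bit_def e level_def side_def)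
  qed
qed

section \<open>An edge towards every larger value\<close>

lemma code_of_side:
  fixes f :: "int \<Rightarrow> int"
  assumes "e = 1 \<or> e = - 1" "\<And>j. f (- j) = - f j" "\<And>j. - 1 \<le> f j \<and> f j \<le> 1"
  obtains A where "valid_code n (e, A)" "\<And>j. \<bar>j\<bar> < int n \<Longrightarrow> side A j = f j"
proof
  let ?A = "{j. \<bar>j\<bar> < int n \<and> f j = 1}"
  show "valid_code n (e, ?A)" using assms by (auto simp: valid_code_def)
  show "side ?A j = f j" if "\<bar>j\<bar> < int n" for j
    using that assms(2)[of j] assms(3)[of j] by (auto simp: side_def)
qed

text \<open>Throughout, \<open>t\<close> and \<open>r\<close> are the level and the side function of \<open>x\<close>, and \<open>j0\<close> is the top bit
  where \<open>x\<close> and \<open>y\<close> differ. A letter \<open>k < 0\<close> with \<open>r k = t - 1\<close> is one whose bit a vertical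
  cover can add. If there is such a \<open>k\<close> below \<open>j0\<close>, adding it leaves the value below that of \<open>y\<close>.
  If there is none, then \<open>z\<close> gets the bit \<open>j0\<close>, or the sign bit, and loses the bits below \<open>j0\<close>
  that can be lost.\<close>

lemma exists_code_edge:
  assumes n: "n \<ge> 1" and x: "valid_code n x" and y: "valid_code n y" and less: "val n x < val n y"
  obtains z where "valid_code n z" "code_edge n x z" "z \<noteq> x" "val n z \<le> val n y"
proof -
  obtain e A where xe: "x = (e, A)" by fastforce
  obtain e' B where ye: "y = (e', B)" by fastforce
  define t r where "t = level e" and "r = side A"
  note vx = x[unfolded xe] and vy = y[unfolded ye]
  have hx: "has_bit x j \<longleftrightarrow> t \<le> r j" for j by (simp add: has_bit_def xe t_def r_def)
  have t: "t = 0 \<or> t = 1" by (simp add: t_def level_def)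
  have t0: "e = - 1" if "t = 0" using that valid_codeD(1)[OF vx] by (auto simp: t_def level_def)
  have t1: "e = 1" if "t = 1" using that by (auto simp: t_def level_def split: if_splits)
  have r: "r (- j) = - r j" "- 1 \<le> r j" "r j \<le> 1" for j
    by (simp_all add: r_def side_uminus side_range)
  have r00: "r 0 = 0" by (simp add: r_def side_zero)
  have hy: "has_bit y j \<longleftrightarrow> level e' \<le> side B j" for j by (simp add: has_bit_def ye)
  have t': "level e' = 0 \<or> level e' = 1" by (simp add: level_def)
  note B = side_uminus[of B] side_range[of B] side_zero[of B]
  obtain j0 where j0: "\<bar>j0\<bar> < int n" "\<not> has_bit x j0" "has_bit y j0"
    and above: "\<And>i. j0 < i \<Longrightarrow> i < int n \<Longrightarrow> has_bit x i = has_bit y i"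
    using val_less_obtain[OF n x y less] by metis
  \<comment> \<open>The bits of \<open>x\<close> that are forced by the absence of the opposite bit
    are also bits of \<open>y\<close>, provided that \<open>y\<close> has negative sign as well.\<close>
  have below: "has_bit y j" if j: "\<bar>j\<bar> < int n" "j < 0" "r j = 1" "j0 < - j" "level e' = 0" for j
  proof -
    have "\<not> has_bit x (- j)" using j(3) t by (auto simp: hx r)
    then have "\<not> has_bit y (- j)" using above[of "- j"] j by auto
    then show ?thesis using j(5) by (auto simp: hy B)
  qed
  show ?thesis
  proof (cases "\<exists>k. \<bar>k\<bar> < int n \<and> k < 0 \<and> k < j0 \<and> r k = t - 1")
    case True
    then obtain k where k: "\<bar>k\<bar> < int n" "k < 0" "k < j0" "r k = t - 1" by blast
    obtain z where z: "valid_code n z" "code_edge n x z" "z \<noteq> x" "\<And>j. has_bit z j \<longleftrightarrow> has_bit x j \<or> j = k"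
      using code_edge_raise[OF n vx k(1)] k by (auto simp: xe t_def r_def)
    have "val n z < val n y"
      using k z(4) j0 above by (intro val_less[OF n z(1) y j0(1)]) auto
    then show ?thesis using that[OF z(1-3)] by simp
  next
    case False
    then have sat: "r k \<noteq> t - 1" if "\<bar>k\<bar> < int n" "k < 0" "k < j0" for k using that by blast
    consider "t = 1" "0 \<le> j0" | "t = 0" "0 < j0" | "t = 0" "j0 = 0" | "j0 < 0" using t by linarith
    then show ?thesis
    proof cases
      case 1
      \<comment> \<open>Saturation leaves no letter to the left of \<open>n\<close>, so the sign of \<open>n\<close> can be flipped.\<close>
      have nz: "r k \<noteq> 0" if "\<bar>k\<bar> < int n" "k \<noteq> 0" for k
        using that sat[of k] sat[of "- k"] 1 by (cases "k < 0") (auto simp: r)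
      let ?z = "(- 1, A) :: int \<times> int set"
      have z: "code_edge n x ?z" "valid_code n ?z"
        using code_edge_flip[OF n] vx nz t1[OF 1(1)] by (auto simp: xe r_def)
      have hz: "has_bit ?z j \<longleftrightarrow> 0 \<le> r j" for j by (simp add: has_bit_def level_def r_def)
      have zx: "has_bit ?z j \<longleftrightarrow> has_bit x j" if "\<bar>j\<bar> < int n" "j \<noteq> 0" for j
        using nz[OF that] r[of j] by (auto simp: hz hx 1(1))
      have "val n ?z \<le> val n y"
      proof (cases "j0 = 0")
        case True
        show ?thesis
        proof (rule val_mono[OF n z(2) y])
          fix i assume i: "\<bar>i\<bar> < int n" "has_bit ?z i"
          consider "i = 0" | "0 < i" | "i < 0" by linarith
          then show "has_bit y i"
          proof cases
            case 3
            then have "has_bit x i" using zx i by auto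
            then have "r i = 1" using r[of i] by (auto simp: hx 1(1))
            moreover have "level e' = 0" using j0(3) True t' by (auto simp: hy B)
            ultimately show ?thesis using below[of i] i 3 True by auto
          qed (use j0 True zx i above in auto)
        qed
      next
        case False
        then have "val n ?z < val n y"
          using 1 j0 above zx by (intro val_less[OF n z(2) y j0(1)]) auto
        then show ?thesis by simp
      qed
      then show ?thesis using that[OF z(2,1)] t1[OF 1(1)] by (auto simp: xe)
    next
      case 2
      have rneg: "0 \<le> r k" if "\<bar>k\<bar> < int n" "k < 0" for k
        using sat[of k] that 2 r[of k] by auto
      have rpos: "r k \<le> 0" if "\<bar>k\<bar> < int n" "0 < k" for k
        using rneg[of "- k"] that r(1)[of k] by auto
      \<comment> \<open>The new pair has sign \<open>+\<close> and \<open>A\<close> made up of \<open>j0\<close> and the bits above it: the least pair that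
        agrees with \<open>x\<close> above \<open>j0\<close> and has the bit \<open>j0\<close>.\<close>
      define p where "p i \<longleftrightarrow> i = j0 \<or> j0 < i \<and> 0 \<le> r i" for i
      define f :: "int \<Rightarrow> int" where "f i = of_bool (p i) - of_bool (p (- i))" for i
      have pp: "0 < i" if "p i" for i using that 2 by (auto simp: p_def)
      obtain C where C: "valid_code n (1, C)" "\<And>j. \<bar>j\<bar> < int n \<Longrightarrow> side C j = f j"
        by (rule code_of_side[of 1 f n]) (auto simp: f_def)
      have hz: "has_bit (1, C) j \<longleftrightarrow> p j" if "\<bar>j\<bar> < int n" for j
        using C(2)[OF that] pp[of j] pp[of "- j"] by (auto simp: has_bit_def level_def f_def)
      have le: "val n (1, C) \<le> val n y"
      proof (rule val_mono[OF n C(1) y])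
        fix i assume i: "\<bar>i\<bar> < int n" "has_bit (1, C) i"
        then have "p i" using hz by blast
        then show "has_bit y i" using i above[of i] j0 hx[of i] 2 by (auto simp: p_def)
      qed
      have r0: "r j0 = - 1" using j0(2) r[of j0] 2 by (auto simp: hx)
      have "code_edge n (e, A) (1, C)"
      proof (rule code_edge_aux[OF n vx C(1)])
        fix a b assume ab: "\<bar>a\<bar> < int n" "\<bar>b\<bar> < int n" "b < a" "side C a < side C b"
        have "f a < f b" using ab C(2) by simp
        then consider "p b" "\<not> p a" | "p (- a)" "\<not> p (- b)"
          by (auto simp: f_def of_bool_def split: if_splits)
        then have "r a \<le> r b"
        proof cases
          case 1
          then have "r a < 0" using ab(3) r0 by (auto simp: p_def)
          then show ?thesis using r[of a] r[of b] by linarith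
        next
          case 2
          then have "r (- b) < 0" using ab(3) r0 by (auto simp: p_def)
          then show ?thesis using r[of a] r[of b] by linarith
        qed
        then show "side A a \<le> side A b" by (simp add: r_def)
      next
        show "0 < j0" "j0 < int n" using 2 j0 by auto
        show "side A j0 \<le> 0" using r0 by (simp add: r_def)
        show "0 \<le> side C j0" using C(2)[OF j0(1)] pp[of "- j0"] 2 by (auto simp: f_def)
        show "\<bar>j0\<bar> < int n" by (rule j0(1))
        show "\<not> has_bit (e, A) j0" using j0(2) by (simp add: xe)
        show "has_bit (1, C) j0" using hz[OF j0(1)] by (simp add: p_def)
      qed
      then show ?thesis using that[OF C(1)] le t0 2 by (auto simp: xe)
    next
      case 3
      then show ?thesis using j0(2) by (simp add: hx r00)
    next
      case 4
      have lev: "level e' = t" using above[of 0] 4 n t t' by (auto simp: hx hy r00 B)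
      have rj0: "r j0 = t - 1"
      proof -
        have "r j0 < t" using j0(2) by (simp add: hx)
        moreover have "r j0 \<noteq> - 1" if "t = 1"
        proof
          assume "r j0 = - 1"
          then have "has_bit x (- j0)" using that by (simp add: hx r)
          then have "has_bit y (- j0)" using above[of "- j0"] 4 j0(1) by auto
          then show False using j0(3) that lev by (auto simp: hy B)
        qed
        ultimately show ?thesis using t r(2)[of j0] by auto
      qed
      \<comment> \<open>Below \<open>j0\<close>, a bit of \<open>x\<close> either has \<open>r j = t\<close> and can be lost, or is forced by the absence of
        the opposite bit.\<close>
      have sat': "r j = t \<or> r j = 1 - 2 * of_bool (t = 1)" if "\<bar>j\<bar> < int n" "j < j0" for j
        using sat[of j] that 4 t r(2,3)[of j] by auto
      show ?thesis
      proof (cases "\<exists>k. \<bar>k\<bar> < int n \<and> k < j0 \<and> r k = t")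
        case False
        obtain z where z: "valid_code n z" "code_edge n x z" "z \<noteq> x" "\<And>j. has_bit z j \<longleftrightarrow> has_bit x j \<or> j = j0"
          using code_edge_raise[OF n vx j0(1)] 4 rj0 by (auto simp: xe t_def r_def)
        have "val n z \<le> val n y"
        proof (rule val_mono[OF n z(1) y])
          fix i assume i: "\<bar>i\<bar> < int n" "has_bit z i"
          show "has_bit y i"
          proof (cases "i < j0")
            case True
            then have "t \<le> r i" "r i \<noteq> t" using False i z(4) by (auto simp: hx)
            then have "r i = 1" "t = 0" using r[of i] t by auto
            then show ?thesis using below[of i] i True 4 lev by auto
          qed (use i z(4) j0(3) above[of i] in force)
        qed
        then show ?thesis using that z by blast
      next
        case True
        then obtain k where k: "\<bar>k\<bar> < int n" "k < j0" "r k = t" by blast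
        \<comment> \<open>The bit \<open>j0\<close> is added, and the bits below it that can be lost are removed; \<open>f\<close> is the resulting
          side function, made odd. Outside the letters it is replaced by \<open>0\<close>, since saturation says nothing there.\<close>
        define g where "g j = (if j = j0 then 1 else if j < j0 \<and> r j = t then - 1 else 0 :: int)" for j
        define f where "f j = r j + g j - g (- j)" for j
        have gpos: "g j = 0" if "0 \<le> j" for j using that 4 by (auto simp: g_def)
        define s where "s j = (if j \<in> {- int n<..<int n} then f j else 0)" for j
        have fr: "- 1 \<le> f j \<and> f j \<le> 1" if "\<bar>j\<bar> < int n" for j
        proof -
          have *: "- 1 \<le> r j + g j \<and> r j + g j \<le> 1" if "\<bar>j\<bar> < int n" for j
            using rj0 r(2,3)[of j] sat'[OF that] t by (auto simp: g_def)
          show ?thesis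
            using *[OF that] *[of "- j"] that gpos[of j] gpos[of "- j"] r(1)[of j]
            by (cases "0 \<le> j") (auto simp: f_def)
        qed
        obtain C where C: "valid_code n (e, C)" "\<And>j. \<bar>j\<bar> < int n \<Longrightarrow> side C j = s j"
          by (rule code_of_side[of e s n]) (use fr valid_codeD(1)[OF vx] in \<open>auto simp: s_def f_def r\<close>)
        have C': "side C j = f j" if "\<bar>j\<bar> < int n" for j using C(2)[OF that] that by (auto simp: s_def)
        have hz: "has_bit (e, C) j \<longleftrightarrow> t \<le> f j" if "\<bar>j\<bar> < int n" for j
          using C'[OF that] by (simp add: has_bit_def t_def)
        have le: "val n (e, C) \<le> val n y"
        proof (rule val_mono[OF n C(1) y])
          fix i assume i: "\<bar>i\<bar> < int n" "has_bit (e, C) i"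
          then have ti: "t \<le> f i" using hz by blast
          consider "i = j0" | "i < j0" | "j0 < i" by linarith
          then show "has_bit y i"
          proof cases
            case 2
            then have "t \<le> r i" "r i \<noteq> t" using ti 4 gpos[of "- i"] t sat'[OF i(1)] by (auto simp: f_def g_def)
            then have "r i = 1" "t = 0" using r[of i] t by auto
            then show ?thesis using below[of i] i 2 4 lev by auto
          next
            case 3
            have "t \<le> r i"
              using ti t 3 rj0 r(1)[of i] r(1)[of j0] by (auto simp: f_def g_def split: if_splits)
            then show ?thesis using above[of i] i 3 by (auto simp: hx)
          qed (use j0 in simp)
        qed
        have f0: "f j0 = t" using rj0 gpos[of "- j0"] 4 by (simp add: f_def g_def)
        have "code_edge n (e, A) (e, C)"
        proof (rule code_edge_aux[OF n vx C(1)])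
          fix a b assume ab: "\<bar>a\<bar> < int n" "\<bar>b\<bar> < int n" "b < a" "side C a < side C b"
          have fab: "f a < f b" using ab C' by simp
          have "r a \<le> r b"
          proof (rule ccontr)
            assume "\<not> r a \<le> r b"
            \<comment> \<open>The change from \<open>r\<close> to \<open>f\<close> is at most \<open>1\<close> at each letter. So reversing a strict inequality
              needs an increase at \<open>b\<close> and a decrease at \<open>a\<close>, and with \<open>b < a\<close> this happens only for
              \<open>b = j0\<close> and \<open>a = - j0\<close>. But \<open>r\<close> vanishes there for level \<open>1\<close>, and \<open>f\<close> for
              level \<open>0\<close>, so that one of the inequalities is not strict.\<close>
            then have "g b - g (- b) = 1" "g a - g (- a) = - 1"
              using fab gpos[of a] gpos[of "- a"] gpos[of b] gpos[of "- b"]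
              by (auto simp: f_def g_def split: if_splits)
            then have "b = j0" "a = - j0"
              using ab(3) 4 by (auto simp: g_def split: if_splits)
            then show False using fab f0 \<open>\<not> r a \<le> r b\<close> rj0 t r(1)[of j0] gpos[of "- j0"] 4
              by (auto simp: f_def g_def)
          qed
          then show "side A a \<le> side A b" by (simp add: r_def)
        next
          show "0 < - k" "- k < int n" using k 4 by auto
          show "side A (- k) \<le> 0" using k(3) t r(1)[of k] by (auto simp: r_def)
          show "0 \<le> side C (- k)"
            using C'[of "- k"] k r(1)[of k] t gpos[of "- k"] 4 by (auto simp: f_def g_def)
          show "\<bar>j0\<bar> < int n" by (rule j0(1))
          show "\<not> has_bit (e, A) j0" using j0(2) by (simp add: xe)
          show "has_bit (e, C) j0" using hz[OF j0(1)] f0 by simp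
        qed
        moreover have "(e, C) \<noteq> (e, A)" using C'[OF j0(1)] f0 rj0 by (auto simp: r_def)
        ultimately show ?thesis using that[OF C(1)] le by (simp add: xe)
      qed
    qed
  qed
qed

text \<open>Each edge provided by \<open>exists_code_edge\<close> strictly increases the valuation: it does not
  decrease it, and distinct valid pairs have distinct values.\<close>

lemma code_path:
  assumes n: "n \<ge> 1" and x: "valid_code n x" and y: "valid_code n y" and le: "val n x \<le> val n y"
  defines "valid_edge \<equiv> \<lambda>x y. valid_code n x \<and> valid_code n y \<and> code_edge n x y"
  shows "valid_edge\<^sup>*\<^sup>* x y"
  using x le
proof (induction "val n y - val n x" arbitrary: x rule: less_induct)
  case less
  show ?case
  proof (cases "val n x = val n y")
    case True
    then show ?thesis using val_inj[OF n less.prems(1) y] by simp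
  next
    case False
    then obtain z where z: "valid_code n z" "code_edge n x z" "z \<noteq> x" "val n z \<le> val n y"
      using exists_code_edge[OF n less.prems(1) y] less.prems(2) by (metis le_neq_implies_less)
    have "val n x < val n z"
      using code_edge_val_le[OF n z(2)] val_inj[OF n less.prems(1) z(1)] z(3) by fastforce
    then have "val n y - val n z < val n y - val n x" using z(4) by linarith
    then have "valid_edge\<^sup>*\<^sup>* z y" using z(1,4) by (rule less.hyps)
    with z(1,2) less.prems(1) show ?thesis
      by (simp add: valid_edge_def converse_rtranclp_into_rtranclp[where b = z])
  qed
qed

section \<open>From pairs to classes\<close>

lemma reeb_vertexE:
  assumes "n \<ge> 1" "X \<in> reeb_vertices n"
  obtains u where "u \<in> hyperoct n" "X = hrel n `` {u}" "vertex_code n X = word_code n u"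
proof -
  obtain u where u: "u \<in> hyperoct n" "X = hrel n `` {u}"
    using assms(2) by (auto simp: reeb_vertices_def quotient_def)
  then have "u \<in> X" using hrel_refl by auto
  then show ?thesis using that u vertex_code_eq[OF assms(2)] by blast
qed

text \<open>A vertex consists of all words with its pair, so edges between classes can be tested on pairs.\<close>

lemma mem_vertex_iff:
  assumes "n \<ge> 1" "X \<in> reeb_vertices n"
  shows "w \<in> X \<longleftrightarrow> w \<in> hyperoct n \<and> word_code n w = vertex_code n X"
proof -
  obtain u where u: "u \<in> hyperoct n" "X = hrel n `` {u}" "vertex_code n X = word_code n u"
    using reeb_vertexE[OF assms] by metis
  have "w \<in> X \<longleftrightarrow> (u, w) \<in> hrel n" by (simp add: u(2))
  also have "\<dots> \<longleftrightarrow> w \<in> hyperoct n \<and> word_code n w = word_code n u"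
    using hrel_hyperoct hrel_word_code hrel_if_same_code[OF assms(1) u(1)] by metis
  finally show ?thesis by (simp only: u(3))
qed

lemma vertex_code_inj:
  assumes "n \<ge> 1" "X \<in> reeb_vertices n" "Y \<in> reeb_vertices n" "vertex_code n X = vertex_code n Y"
  shows "X = Y"
  using mem_vertex_iff[OF assms(1,2)] mem_vertex_iff[OF assms(1,3)] assms(4) by auto

lemma valid_vertex_code:
  assumes "n \<ge> 1" "X \<in> reeb_vertices n"
  shows "valid_code n (vertex_code n X)"
  using reeb_vertexE[OF assms] valid_word_code[OF assms(1)] by metis

lemma vertex_of_code:
  assumes n: "n \<ge> 1" and x: "valid_code n x"
  obtains X where "X \<in> reeb_vertices n" "vertex_code n X = x"
proof -
  obtain e A where eA: "x = (e, A)" by fastforce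
  obtain w where w: "w \<in> hyperoct n" "word_code n w = x"
    using exists_extremal_word[OF n x[unfolded eA], of 1] unfolding eA by blast
  have X: "hrel n `` {w} \<in> reeb_vertices n" using w(1) by (auto simp: reeb_vertices_def quotient_def)
  moreover have "w \<in> hrel n `` {w}" using hrel_refl[OF w(1)] by auto
  ultimately show ?thesis using that vertex_code_eq w(2) by metis
qed

lemma aug_edge_iff:
  assumes "n \<ge> 1" "X \<in> reeb_vertices n" "Y \<in> reeb_vertices n"
  shows "aug_edge n X Y \<longleftrightarrow> code_edge n (vertex_code n X) (vertex_code n Y)"
  using assms mem_vertex_iff[OF assms(1,2)] mem_vertex_iff[OF assms(1,3)]
  unfolding aug_edge_def reeb_edge_def aux_edge_def code_edge_def aux_pair_def by blast

lemma aug_edge_vertices: "aug_edge n X Y \<Longrightarrow> X \<in> reeb_vertices n \<and> Y \<in> reeb_vertices n"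
  by (auto simp: aug_edge_def reeb_edge_def aux_edge_def)

lemma aug_reeb_iff:
  assumes n: "n \<ge> 1" and X: "X \<in> reeb_vertices n" and Y: "Y \<in> reeb_vertices n"
  shows "(X, Y) \<in> aug_reeb n \<longleftrightarrow> val n (vertex_code n X) \<le> val n (vertex_code n Y)"
proof
  assume "(X, Y) \<in> aug_reeb n"
  then have "(aug_edge n)\<^sup>*\<^sup>* X Y" by (simp add: aug_reeb_def)
  then show "val n (vertex_code n X) \<le> val n (vertex_code n Y)"
  proof induction
    case (step Y Z)
    then show ?case
      using aug_edge_vertices aug_edge_iff[OF n] code_edge_val_le[OF n] order_trans by meson
  qed simp
next
  assume le: "val n (vertex_code n X) \<le> val n (vertex_code n Y)"
  have "\<exists>Z. Z \<in> reeb_vertices n \<and> vertex_code n Z = c \<and> (aug_edge n)\<^sup>*\<^sup>* X Z"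
    if "(\<lambda>x y. valid_code n x \<and> valid_code n y \<and> code_edge n x y)\<^sup>*\<^sup>* (vertex_code n X) c" for c
    using that
  proof induction
    case (step c d)
    then obtain Z where Z: "Z \<in> reeb_vertices n" "vertex_code n Z = c" "(aug_edge n)\<^sup>*\<^sup>* X Z" by blast
    obtain W where W: "W \<in> reeb_vertices n" "vertex_code n W = d"
      using vertex_of_code[OF n] step by metis
    have "aug_edge n Z W" using aug_edge_iff[OF n Z(1) W(1)] Z W step by simp
    with Z(3) have "(aug_edge n)\<^sup>*\<^sup>* X W" by (rule rtranclp.rtrancl_into_rtrancl)
    then show ?case using W by blast
  qed (use X in blast)
  then obtain Z where "Z \<in> reeb_vertices n" "vertex_code n Z = vertex_code n Y" "(aug_edge n)\<^sup>*\<^sup>* X Z"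
    using code_path[OF n valid_vertex_code[OF n X] valid_vertex_code[OF n Y] le] by blast
  then show "(X, Y) \<in> aug_reeb n"
    using vertex_code_inj[OF n _ Y] X Y by (auto simp: aug_reeb_def)
qed

theorem corollary3p11:
  fixes n :: nat
  assumes "n \<ge> 1"
  shows "linear_order_on (reeb_vertices n) (aug_reeb n) \<and>
    (\<forall>X \<in> reeb_vertices n. \<forall>Y \<in> reeb_vertices n.
       (X, Y) \<in> aug_reeb n \<longleftrightarrow> val n (vertex_code n X) \<le> val n (vertex_code n Y))"
proof
  show "\<forall>X \<in> reeb_vertices n. \<forall>Y \<in> reeb_vertices n.
       (X, Y) \<in> aug_reeb n \<longleftrightarrow> val n (vertex_code n X) \<le> val n (vertex_code n Y)"
    using aug_reeb_iff[OF assms] by blast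
  have dom: "(X, Y) \<in> aug_reeb n \<Longrightarrow> X \<in> reeb_vertices n \<and> Y \<in> reeb_vertices n" for X Y
    by (simp add: aug_reeb_def)
  have "antisym (aug_reeb n)"
  proof (rule antisymI)
    fix X Y assume XY: "(X, Y) \<in> aug_reeb n" "(Y, X) \<in> aug_reeb n"
    then have X: "X \<in> reeb_vertices n" and Y: "Y \<in> reeb_vertices n" using dom by auto
    have "val n (vertex_code n X) = val n (vertex_code n Y)"
      using XY aug_reeb_iff[OF assms X Y] aug_reeb_iff[OF assms Y X] by simp
    then show "X = Y"
      using val_inj[OF assms valid_vertex_code[OF assms X] valid_vertex_code[OF assms Y]]
        vertex_code_inj[OF assms X Y] by blast
  qed
  moreover have "trans (aug_reeb n)"
    by (rule transI) (auto simp: aug_reeb_def intro: rtranclp_trans)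
  moreover have "aug_reeb n \<subseteq> reeb_vertices n \<times> reeb_vertices n" using dom by auto
  moreover have "refl_on (reeb_vertices n) (aug_reeb n)"
    by (rule refl_onI) (simp add: aug_reeb_def)
  moreover have "total_on (reeb_vertices n) (aug_reeb n)"
  proof (rule total_onI)
    fix X Y assume XY: "X \<in> reeb_vertices n" "Y \<in> reeb_vertices n"
    show "(X, Y) \<in> aug_reeb n \<or> (Y, X) \<in> aug_reeb n"
      using aug_reeb_iff[OF assms XY] aug_reeb_iff[OF assms XY(2,1)] by linarith
  qed
  ultimately show "linear_order_on (reeb_vertices n) (aug_reeb n)"
    by (simp add: linear_order_on_def partial_order_on_def preorder_on_def)
qed

end
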